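(* Let $m>0$ and let $\mu$ be a probability measure on $\mathbb T=\mathbb R/2\pi\mathbb Z$ whose cumulative distribution function $F_\mu$ satisfies $F_\mu(\theta+h)-F_\mu(\theta)\ge mh$ for all $\theta\in\mathbb R$ and all $h\ge 0$. Then there exists a viscosity solution $F:[0,\infty)\times\mathbb R\to\mathbb R$ of $$\partial_t F(t,\theta)+\frac1\pi\left(\arctan\left(\frac{A_0[F(t,\cdot)](\theta)}{(\partial_\theta F(t,\theta))_+}\right)+\frac{\pi}{2}\right)=0\quad\text{in }(0,+\infty)\times\mathbb R$$ with initial condition $F_\mu$, which satisfies $F(t,\theta+h)-F(t,\theta)\ge mh$ for all $t\ge 0$, $\theta\in\mathbb R$ and $h\ge 0$.
   Context: **Cumulative distribution function.** A probability measure $\mu$ on $\mathbb T$ is identified with its $2\pi$-periodic lift to $\mathbb R$. Set $F_\mu(x)=\mu([0,x])$ if $x\ge 0$ and $F_\mu(x)=-\mu((x,0))$ if $x<0$. Thus $F_\mu$ is non-decreasing, right-continuous and $F_\mu(x+2\pi)=F_\mu(x)+1$. **Envelopes.** For a locally bounded function $F$ on a subset $\Omega$ of $\mathbb R^d$ and $x\in\Omega$: $F_*(x)=\liminf_{y\to x}F(y)$ and $F^*(x)=\limsup_{y\to x}F(y)$ (lower and upper semicontinuous envelopes; $y\in\Omega$, $y=x$ allowed). **Function spaces.** $\mathcal F_{t,2\pi}$ is the set of functions $F:[0,\infty)\times\mathbb R\to\mathbb R$ for which there is $a\in\mathbb R$ with $F(t,x+2\pi)=F(t,x)+a$ for all $t\ge0$,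 $x\in\mathbb R$. $C^{1,1}_{t,2\pi}$ is the set of $C^1$ functions $\phi:[0,\infty)\times\mathbb R\to\mathbb R$ such that $\partial_x\phi$ is Lipschitz and $\phi\in\mathcal F_{t,2\pi}$. **Half-Laplacian.** For a $C^1$ function $f:\mathbb R\to\mathbb R$ with $f'$ Lipschitz and $f(x+2\pi)-f(x)$ constant, $$A_0[f](\theta)=\frac1{8\pi}\int_{-\pi}^{\pi}\frac{2f(\theta)-f(\theta-\theta')-f(\theta+\theta')}{\sin^2(\theta'/2)}\,d\theta'.$$ **Viscosity solutions.** Write $y_+=\max(y,0)$. - An upper semicontinuous $F\in\mathcal F_{t,2\pi}$ is a viscosity subsolution if for every $\phi\in C^{1,1}_{t,2\pi}$ and every point $(t_0,\theta_0)\in(0,\infty)\times\mathbb R$ of strict maximum of $F-\phi$ with $\partial_\theta\phi(t_0,\theta_0)\ne0$, $$\partial_t\phi(t_0,\theta_0)+\frac1\pi\left(\arctan\left(\frac{A_0[\phi(t_0,\cdot)](\theta_0)}{(\partial_\theta\phi(t_0,\theta_0))_+}\right)+\frac\pi2\right)\le0.$$ - A lower semicontinuous $F\in\mathcal F_{t,2\pi}$ is a viscosity supersolution if the same holds with "strict maximum" replaced by "strict minimum" and $\le0$ replaced by $\ge0$. - A viscosity solution is a locally bounded function $F$ such that $F$ is a subsolution and $F_*$ is a supersolution. - $F$ has initial condition $F_0$ if $F^*(0,\cdot)\le (F_0)^*$ and $F_*(0,\cdot)\ge(F_0)_*$. Here a strict maximum (minimum) is a maximum (minimum) over $[0,\infty)\times\mathbb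 R$, attained only at the points $(t_0,\theta_0+2\pi k)$, $k\in\mathbb Z$. For functions $F$ with $F(t,\theta+h)-F(t,\theta)\ge mh$ for all $t,h\ge 0$, $\theta\in\mathbb R$, one always has $\partial_\theta\phi(t_0,\theta_0)\ge m>0$ at such points, so no division by zero occurs. *)

theory Defs
  imports "HOL-Analysis.Analysis"
begin

section \<open>Probability measures on the torus\<close>

text \<open>A probability measure on \<open>\<real> / 2\<pi>\<int>\<close> is represented by its lift, the Borel measure on the
  line that is invariant under translation by \<open>2\<pi>\<close> and has mass 1 on a fundamental domain.\<close>

definition torus_prob_measure :: "real measure \<Rightarrow> bool" where
  "torus_prob_measure \<mu> \<longleftrightarrow>
     sets \<mu> = sets borel \<and>
     (\<forall>A\<in>sets borel. emeasure \<mu> ((\<lambda>x. x + 2 * pi) ` A) = emeasure \<mu> A) \<and>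
     emeasure \<mu> {0..<2 * pi} = 1"

definition torus_cdf :: "real measure \<Rightarrow> real \<Rightarrow> real" where
  "torus_cdf \<mu> x = (if x \<ge> 0 then measure \<mu> {0..x} else - measure \<mu> {x<..<0})"

section \<open>Semicontinuous envelopes\<close>

text \<open>The filter \<open>inf (nhds x) (principal S)\<close> describes \<open>y \<rightarrow> x\<close> with \<open>y \<in> S\<close>, the value \<open>y = x\<close>
  being allowed (unlike \<open>at x within S\<close>).  The limits are taken in the extended reals; they are
  finite, hence unaffected by \<open>real_of_ereal\<close>, at the points of \<open>S\<close> if \<open>f\<close> is locally bounded
  on \<open>S\<close>.\<close>

definition lower_envelope :: "'a::topological_space set \<Rightarrow> ('a \<Rightarrow> real) \<Rightarrow> 'a \<Rightarrow> real" where
  "lower_envelope S f x = real_of_ereal (Liminf (inf (nhds x) (principal S)) (\<lambda>y. ereal (f y)))"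

definition upper_envelope :: "'a::topological_space set \<Rightarrow> ('a \<Rightarrow> real) \<Rightarrow> 'a \<Rightarrow> real" where
  "upper_envelope S f x = real_of_ereal (Limsup (inf (nhds x) (principal S)) (\<lambda>y. ereal (f y)))"

definition lsc_on :: "'a::topological_space set \<Rightarrow> ('a \<Rightarrow> real) \<Rightarrow> bool" where
  "lsc_on S f \<longleftrightarrow>
     (\<forall>x\<in>S. ereal (f x) \<le> Liminf (inf (nhds x) (principal S)) (\<lambda>y. ereal (f y)))"

definition usc_on :: "'a::topological_space set \<Rightarrow> ('a \<Rightarrow> real) \<Rightarrow> bool" where
  "usc_on S f \<longleftrightarrow>
     (\<forall>x\<in>S. Limsup (inf (nhds x) (principal S)) (\<lambda>y. ereal (f y)) \<le> ereal (f x))"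

definition locally_bounded_on :: "'a::metric_space set \<Rightarrow> ('a \<Rightarrow> real) \<Rightarrow> bool" where
  "locally_bounded_on S f \<longleftrightarrow> (\<forall>x\<in>S. \<exists>r>0. bounded (f ` (S \<inter> ball x r)))"

section \<open>Function spaces\<close>

text \<open>Functions on \<open>[0,\<infinity>) \<times> \<real>\<close> are total functions on \<open>real \<times> real\<close>; every notion below only
  depends on their values on \<open>spacetime\<close>.\<close>

definition spacetime :: "(real \<times> real) set" where
  "spacetime = {0..} \<times> UNIV"

definition periodic_increment :: "(real \<times> real \<Rightarrow> real) \<Rightarrow> bool" where
  "periodic_increment F \<longleftrightarrow> (\<exists>a. \<forall>t\<ge>0. \<forall>x. F (t, x + 2 * pi) = F (t, x) + a)"

text \<open>The time derivative is one-sided at \<open>t = 0\<close>.\<close>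

definition dt :: "(real \<times> real \<Rightarrow> real) \<Rightarrow> real \<times> real \<Rightarrow> real" where
  "dt \<phi> = (\<lambda>(t, x). vector_derivative (\<lambda>s. \<phi> (s, x)) (at t within {0..}))"

definition dx :: "(real \<times> real \<Rightarrow> real) \<Rightarrow> real \<times> real \<Rightarrow> real" where
  "dx \<phi> = (\<lambda>(t, x). deriv (\<lambda>y. \<phi> (t, y)) x)"

definition C1_spacetime :: "(real \<times> real \<Rightarrow> real) \<Rightarrow> bool" where
  "C1_spacetime \<phi> \<longleftrightarrow>
     (\<forall>p\<in>spacetime. (\<phi> has_derivative (\<lambda>(h, k). dt \<phi> p * h + dx \<phi> p * k)) (at p within spacetime)) \<and>
     continuous_on spacetime (dt \<phi>) \<and> continuous_on spacetime (dx \<phi>)"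

definition test_function :: "(real \<times> real \<Rightarrow> real) \<Rightarrow> bool" where
  "test_function \<phi> \<longleftrightarrow>
     C1_spacetime \<phi> \<and> (\<exists>L. L-lipschitz_on spacetime (dx \<phi>)) \<and> periodic_increment \<phi>"

section \<open>The equation and its viscosity solutions\<close>

definition half_laplacian :: "(real \<Rightarrow> real) \<Rightarrow> real \<Rightarrow> real" where
  "half_laplacian f \<theta> =
     1 / (8 * pi) *
       (LINT y:{-pi..pi}|lborel. (2 * f \<theta> - f (\<theta> - y) - f (\<theta> + y)) / (sin (y / 2))\<^sup>2)"

text \<open>The left-hand side of the equation.  For \<open>dx \<phi> p < 0\<close> the quotient is a division by zero,
  which HOL evaluates to 0; this is immaterial for functions whose increments in the second
  variable are bounded below by \<open>m * h\<close> with \<open>m > 0\<close>, since then \<open>dx \<phi> p \<ge> m\<close> at every contact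
  point.\<close>

definition equation_lhs :: "(real \<times> real \<Rightarrow> real) \<Rightarrow> real \<times> real \<Rightarrow> real" where
  "equation_lhs \<phi> = (\<lambda>(t, \<theta>).
     dt \<phi> (t, \<theta>) +
     1 / pi * (arctan (half_laplacian (\<lambda>x. \<phi> (t, x)) \<theta> / max (dx \<phi> (t, \<theta>)) 0) + pi / 2))"

definition strict_max_at :: "(real \<times> real \<Rightarrow> real) \<Rightarrow> real \<Rightarrow> real \<Rightarrow> bool" where
  "strict_max_at g t0 \<theta>0 \<longleftrightarrow>
     (\<forall>p\<in>spacetime. g p \<le> g (t0, \<theta>0)) \<and>
     (\<forall>p\<in>spacetime. g p = g (t0, \<theta>0) \<longrightarrow> (\<exists>k::int. p = (t0, \<theta>0 + 2 * pi * of_int k)))"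

definition strict_min_at :: "(real \<times> real \<Rightarrow> real) \<Rightarrow> real \<Rightarrow> real \<Rightarrow> bool" where
  "strict_min_at g t0 \<theta>0 \<longleftrightarrow>
     (\<forall>p\<in>spacetime. g p \<ge> g (t0, \<theta>0)) \<and>
     (\<forall>p\<in>spacetime. g p = g (t0, \<theta>0) \<longrightarrow> (\<exists>k::int. p = (t0, \<theta>0 + 2 * pi * of_int k)))"

definition viscosity_subsolution :: "(real \<times> real \<Rightarrow> real) \<Rightarrow> bool" where
  "viscosity_subsolution F \<longleftrightarrow>
     usc_on spacetime F \<and> periodic_increment F \<and>
     (\<forall>\<phi> t0 \<theta>0. test_function \<phi> \<and> t0 > 0 \<and> strict_max_at (\<lambda>p. F p - \<phi> p) t0 \<theta>0 \<and>
        dx \<phi> (t0, \<theta>0) \<noteq> 0 \<longrightarrow> equation_lhs \<phi> (t0, \<theta>0) \<le> 0)"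

definition viscosity_supersolution :: "(real \<times> real \<Rightarrow> real) \<Rightarrow> bool" where
  "viscosity_supersolution F \<longleftrightarrow>
     lsc_on spacetime F \<and> periodic_increment F \<and>
     (\<forall>\<phi> t0 \<theta>0. test_function \<phi> \<and> t0 > 0 \<and> strict_min_at (\<lambda>p. F p - \<phi> p) t0 \<theta>0 \<and>
        dx \<phi> (t0, \<theta>0) \<noteq> 0 \<longrightarrow> equation_lhs \<phi> (t0, \<theta>0) \<ge> 0)"

definition viscosity_solution :: "(real \<times> real \<Rightarrow> real) \<Rightarrow> bool" where
  "viscosity_solution F \<longleftrightarrow>
     locally_bounded_on spacetime F \<and>
     viscosity_subsolution F \<and>
     viscosity_supersolution (lower_envelope spacetime F)"

definition has_initial_condition :: "(real \<times> real \<Rightarrow> real) \<Rightarrow> (real \<Rightarrow> real) \<Rightarrow> bool" where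
  "has_initial_condition F F0 \<longleftrightarrow>
     (\<forall>x. upper_envelope spacetime F (0, x) \<le> upper_envelope UNIV F0 x) \<and>
     (\<forall>x. lower_envelope spacetime F (0, x) \<ge> lower_envelope UNIV F0 x)"

end

theory Submission
  imports Defs
begin

text \<open>Perron's method. Let \<open>G\<close> be the upper envelope of the cumulative distribution function. As
  the nonlinear term of the equation lies in \<open>[0, 1]\<close>, the lower envelope of \<open>G\<close> is a stationary
  supersolution and \<open>G x - t\<close> is a subsolution; these barriers have the right initial condition. The
  solution is the upper envelope of the supremum of all subsolutions below \<open>G\<close>, which is the
  largest such subsolution. It inherits the slope bound from \<open>G\<close> since the class of these
  subsolutions is stable under \<open>u(t, x) \<mapsto> u(t, x - h) + m * h\<close>; no comparison principle is
  needed.\<close>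

section \<open>Semicontinuity\<close>

text \<open>What shapes the proof is nonlocality: \<open>half_laplacian\<close> sees a whole period
  of its argument, and \<open>strict_max_at\<close> asks for a maximum over all times that is unique
  modulo the period. Local bump arguments must therefore be made global. In space, members of the
  class gain exactly 1 per period, and a test function touching one of them has to do the same;
  differences are then periodic, and one compact period suffices. In time, which is unbounded, the
  subsolution test adds a quadratic penalty, invisible to the half-Laplacian because it is constant
  on each time slice. The supersolution test raises the solution on a full slab of times, at every
  position, since monotonicity of the half-Laplacian needs an ordering along the entire slice and
  not only near the contact point. Maxima found on the way need not be strict; a vanishing
  perturbation repairs this. Excluding contact points with \<open>dx \<phi> = 0\<close> is what
  makes \<open>equation_lhs\<close> continuous where it is tested.\<close>

lemma eventually_nhds_principal:
  fixes x :: "'a::metric_space"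
  shows "eventually P (inf (nhds x) (principal S)) \<longleftrightarrow> (\<exists>r>0. \<forall>y\<in>S. dist y x < r \<longrightarrow> P y)"
  unfolding eventually_inf_principal eventually_nhds_metric by blast

text \<open>Replaces extended-real limits by strict real thresholds, the form in which
  semicontinuity is used from here on.\<close>

lemma lsc_on_iff:
  fixes f :: "'a::metric_space \<Rightarrow> real"
  shows "lsc_on S f \<longleftrightarrow> (\<forall>x\<in>S. \<forall>c<f x. \<exists>r>0. \<forall>y\<in>S. dist y x < r \<longrightarrow> c < f y)"
proof -
  have "ereal a \<le> Liminf N (\<lambda>y. ereal (f y)) \<longleftrightarrow> (\<forall>c<a. eventually (\<lambda>y. c < f y) N)"
    for a :: real and N :: "'a filter"
    unfolding le_Liminf_iff
  proof safe
    fix c assume "\<forall>y<ereal a. \<forall>\<^sub>F x in N. y < ereal (f x)" "c < a"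
    then show "eventually (\<lambda>y. c < f y) N" by (auto dest: spec[of _ "ereal c"])
  next
    fix c assume "\<forall>c<a. eventually (\<lambda>y. c < f y) N" "c < ereal a"
    then show "\<forall>\<^sub>F x in N. c < ereal (f x)" by (cases c) auto
  qed
  then show ?thesis unfolding lsc_on_def eventually_nhds_principal[symmetric] by blast
qed

lemma usc_on_iff_lsc_on_uminus: "usc_on S f \<longleftrightarrow> lsc_on S (\<lambda>x. - f x)"
proof -
  have "Limsup N (\<lambda>y. ereal (f y)) \<le> ereal c \<longleftrightarrow> ereal (- c) \<le> Liminf N (\<lambda>y. ereal (- f y))"
    for N :: "'a filter" and c
    using ereal_Liminf_uminus[of N "\<lambda>y. ereal (f y)"] by (simp flip: uminus_ereal.simps)
  then show ?thesis unfolding usc_on_def lsc_on_def by simp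
qed

lemma usc_on_iff:
  fixes f :: "'a::metric_space \<Rightarrow> real"
  shows "usc_on S f \<longleftrightarrow> (\<forall>x\<in>S. \<forall>c>f x. \<exists>r>0. \<forall>y\<in>S. dist y x < r \<longrightarrow> f y < c)"
proof -
  have "(\<forall>c. c < - a \<longrightarrow> P c) \<longleftrightarrow> (\<forall>c>a. P (- c))" for a :: real and P
    by (metis minus_minus neg_less_iff_less)
  then show ?thesis unfolding usc_on_iff_lsc_on_uminus lsc_on_iff by simp
qed

text \<open>\<open>real_of_ereal\<close> would turn an infinite limit into the default 0. Local
  boundedness bounds the limit from below, and the admissible choice \<open>y = x\<close> bounds it
  by \<open>f x\<close>, so it is a real number; the three facts then replace the extended reals
  altogether.\<close>

lemma lower_envelope_properties:
  fixes f :: "'a::metric_space \<Rightarrow> real"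
  assumes "locally_bounded_on S f" "x \<in> S"
  shows lower_envelope_le: "lower_envelope S f x \<le> f x"
    and less_lower_envelopeD:
      "c < lower_envelope S f x \<Longrightarrow> \<exists>r>0. \<forall>y\<in>S. dist y x < r \<longrightarrow> c < f y"
    and le_lower_envelopeI:
      "r > 0 \<Longrightarrow> (\<And>y. y \<in> S \<Longrightarrow> dist y x < r \<Longrightarrow> c \<le> f y) \<Longrightarrow> c \<le> lower_envelope S f x"
proof -
  let ?N = "inf (nhds x) (principal S)"
  define l where "l = Liminf ?N (\<lambda>y. ereal (f y))"
  have le: "l \<le> ereal c" if "c \<ge> f x" for c
  proof (rule ccontr)
    assume "\<not> l \<le> ereal c"
    then have "\<forall>\<^sub>F y in ?N. ereal c < ereal (f y)"
      by (subst (asm) not_le) (use le_Liminf_iff[of l ?N "\<lambda>y. ereal (f y)"] l_def in blast)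
    then show False using that assms(2) unfolding eventually_nhds_principal by force
  qed
  have ge: "ereal c \<le> l" if "r > 0" "\<And>y. y \<in> S \<Longrightarrow> dist y x < r \<Longrightarrow> c \<le> f y" for c r
    unfolding l_def by (rule Liminf_bounded) (use that in \<open>auto simp: eventually_nhds_principal\<close>)
  obtain r b where "r > 0" "\<forall>y\<in>f ` (S \<inter> ball x r). norm y \<le> b"
    using assms unfolding locally_bounded_on_def bounded_iff by blast
  then have "r > 0" "\<And>y. y \<in> S \<Longrightarrow> dist y x < r \<Longrightarrow> \<bar>f y\<bar> \<le> b"
    by (auto simp: dist_commute)
  then have "ereal (- b) \<le> l" by (intro ge) (auto simp: abs_le_iff minus_le_iff)
  with le[of "f x"] obtain a where a: "l = ereal a" by (cases l) auto
  then have eq: "lower_envelope S f x = a"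
    by (simp add: lower_envelope_def flip: l_def)
  show "lower_envelope S f x \<le> f x" using le[of "f x"] a eq by simp
  show "\<exists>r>0. \<forall>y\<in>S. dist y x < r \<longrightarrow> c < f y" if "c < lower_envelope S f x"
  proof -
    have "\<forall>\<^sub>F y in ?N. ereal c < ereal (f y)"
      using le_Liminf_iff[of l ?N "\<lambda>y. ereal (f y)"] that a eq l_def
      by (metis less_ereal.simps(1) order_refl)
    then show ?thesis by (simp add: eventually_nhds_principal)
  qed
  show "c \<le> lower_envelope S f x" if "r > 0" "\<And>y. y \<in> S \<Longrightarrow> dist y x < r \<Longrightarrow> c \<le> f y" for r
    using ge[OF that] a eq by simp
qed

lemma upper_envelope_eq: "upper_envelope S f x = - lower_envelope S (\<lambda>x. - f x) x"
  unfolding upper_envelope_def lower_envelope_def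
  using ereal_Liminf_uminus[of "inf (nhds x) (principal S)" "\<lambda>y. ereal (f y)"]
  by (simp flip: uminus_ereal.simps)

lemma locally_bounded_on_uminus: "locally_bounded_on S (\<lambda>x. - f x) \<longleftrightarrow> locally_bounded_on S f"
  unfolding locally_bounded_on_def bounded_iff by simp

lemma upper_envelope_properties:
  fixes f :: "'a::metric_space \<Rightarrow> real"
  assumes "locally_bounded_on S f" "x \<in> S"
  shows upper_envelope_ge: "f x \<le> upper_envelope S f x"
    and upper_envelope_lessD:
      "upper_envelope S f x < c \<Longrightarrow> \<exists>r>0. \<forall>y\<in>S. dist y x < r \<longrightarrow> f y < c"
    and upper_envelope_leI:
      "r > 0 \<Longrightarrow> (\<And>y. y \<in> S \<Longrightarrow> dist y x < r \<Longrightarrow> f y \<le> c) \<Longrightarrow> upper_envelope S f x \<le> c"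
proof -
  note * = lower_envelope_properties[of S "\<lambda>x. - f x", unfolded locally_bounded_on_uminus, OF assms]
  show "f x \<le> upper_envelope S f x" using *(1) by (simp add: upper_envelope_eq)
  show "\<exists>r>0. \<forall>y\<in>S. dist y x < r \<longrightarrow> f y < c" if "upper_envelope S f x < c"
    using *(2)[of "- c"] that by (simp add: upper_envelope_eq)
  show "upper_envelope S f x \<le> c" if "r > 0" "\<And>y. y \<in> S \<Longrightarrow> dist y x < r \<Longrightarrow> f y \<le> c" for r
    using *(3)[of r "- c"] that by (simp add: upper_envelope_eq)
qed

lemma locally_bounded_onI:
  fixes f :: "'a::metric_space \<Rightarrow> real"
  assumes "\<And>x. x \<in> S \<Longrightarrow> \<exists>r>0. \<exists>a b. \<forall>y\<in>S. dist y x < r \<longrightarrow> a \<le> f y \<and> f y \<le> b"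
  shows "locally_bounded_on S f"
  unfolding locally_bounded_on_def
proof
  fix x assume "x \<in> S"
  then obtain r a b where r: "r > 0" "\<forall>y\<in>S. dist y x < r \<longrightarrow> a \<le> f y \<and> f y \<le> b"
    using assms by blast
  then have "f ` (S \<inter> ball x r) \<subseteq> {a..b}" by (auto simp: dist_commute)
  then show "\<exists>r>0. bounded (f ` (S \<inter> ball x r))"
    using r bounded_closed_interval bounded_subset by blast
qed

lemma lsc_on_lower_envelope:
  fixes f :: "'a::metric_space \<Rightarrow> real"
  assumes "locally_bounded_on S f"
  shows "lsc_on S (lower_envelope S f)"
  unfolding lsc_on_iff
proof (intro ballI allI impI)
  fix x c assume x: "x \<in> S" and "c < lower_envelope S f x"
  \<comment> \<open>Passing to the envelope at nearby points keeps only a non-strict bound; the gap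
    between \<open>c\<close> and \<open>d\<close> restores strictness.\<close>
  then obtain d where d: "c < d" "d < lower_envelope S f x" using dense by blast
  obtain r where r: "r > 0" "\<forall>y\<in>S. dist y x < r \<longrightarrow> d < f y"
    using less_lower_envelopeD[OF assms x d(2)] by blast
  have "d \<le> lower_envelope S f y" if "y \<in> S" "dist y x < r / 2" for y
  proof (rule le_lower_envelopeI[OF assms that(1), of "r / 2"])
    fix z assume "z \<in> S" "dist z y < r / 2"
    moreover have "dist z x \<le> dist z y + dist y x" by (rule dist_triangle)
    ultimately show "d \<le> f z" using r that by force
  qed (use r in simp)
  then show "\<exists>r>0. \<forall>y\<in>S. dist y x < r \<longrightarrow> c < lower_envelope S f y"
    using r d by (intro exI[of _ "r / 2"]) force
qed

lemma usc_on_upper_envelope: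
  fixes f :: "'a::metric_space \<Rightarrow> real"
  assumes "locally_bounded_on S f"
  shows "usc_on S (upper_envelope S f)"
  using lsc_on_lower_envelope[of S "\<lambda>x. - f x"] assms
  by (simp add: usc_on_iff_lsc_on_uminus upper_envelope_eq locally_bounded_on_uminus)

text \<open>Points near \<open>x + v\<close> are pulled back to points near \<open>x\<close>, which
  explains the direction of the domain condition (it is reversed for the upper envelope). The shift
  lemmas serve for the period, with \<open>c\<close> equal to 1 or -1, and for monotonicity and
  slope.\<close>

lemma lower_envelope_shift:
  fixes f :: "'a::real_normed_vector \<Rightarrow> real"
  assumes "locally_bounded_on S f" "x \<in> S" "x + v \<in> S" "\<And>y. y + v \<in> S \<Longrightarrow> y \<in> S"
    and "\<And>y. y \<in> S \<Longrightarrow> f y + c \<le> f (y + v)"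
  shows "lower_envelope S f x + c \<le> lower_envelope S f (x + v)"
proof (rule dense_le)
  fix d assume "d < lower_envelope S f x + c"
  then have "d - c < lower_envelope S f x" by simp
  then obtain r where r: "r > 0" "\<forall>y\<in>S. dist y x < r \<longrightarrow> d - c < f y"
    using less_lower_envelopeD[OF assms(1,2)] by blast
  show "d \<le> lower_envelope S f (x + v)"
  proof (rule le_lower_envelopeI[OF assms(1,3) r(1)])
    fix y assume y: "y \<in> S" "dist y (x + v) < r"
    then have "y - v \<in> S" "dist (y - v) x < r" using assms(4)[of "y - v"]
      by (auto simp: dist_norm algebra_simps)
    with r assms(5)[of "y - v"] show "d \<le> f y" by force
  qed
qed

lemma upper_envelope_shift:
  fixes f :: "'a::real_normed_vector \<Rightarrow> real"
  assumes "locally_bounded_on S f" "x \<in> S" "x + v \<in> S" "\<And>y. y \<in> S \<Longrightarrow> y + v \<in> S"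
    and "\<And>y. y \<in> S \<Longrightarrow> f y + c \<le> f (y + v)"
  shows "upper_envelope S f x + c \<le> upper_envelope S f (x + v)"
proof (rule dense_ge)
  fix d assume "upper_envelope S f (x + v) < d"
  then obtain r where r: "r > 0" "\<forall>y\<in>S. dist y (x + v) < r \<longrightarrow> f y < d"
    using upper_envelope_lessD[OF assms(1,3)] by blast
  have "upper_envelope S f x \<le> d - c"
  proof (rule upper_envelope_leI[OF assms(1,2) r(1)])
    fix y assume y: "y \<in> S" "dist y x < r"
    then have "y + v \<in> S" "dist (y + v) (x + v) < r" using assms(4)[of y] by auto
    with r assms(5)[OF y(1)] show "f y \<le> d - c" by force
  qed
  then show "upper_envelope S f x + c \<le> d" by simp
qed

section \<open>Maxima of semicontinuous functions\<close>

text \<open>Without a maximum, near each \<open>x\<close> the function stays below its value at some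
  \<open>y x\<close>. In a finite subcover the best of these values is itself taken inside one of
  the balls, hence beaten by another.\<close>

lemma usc_on_attains_max:
  fixes f :: "'a::metric_space \<Rightarrow> real"
  assumes "usc_on S f" "compact K" "K \<subseteq> S" "K \<noteq> {}"
  shows "\<exists>x\<in>K. \<forall>y\<in>K. f y \<le> f x"
proof (rule ccontr)
  assume "\<not> ?thesis"
  then have "\<exists>y\<in>K. \<exists>r>0. \<forall>z\<in>K. dist z x < r \<longrightarrow> f z < f y" if "x \<in> K" for x
    using assms(1,3) that unfolding usc_on_iff by (meson not_le subsetD)
  then obtain y r where y: "\<And>x. x \<in> K \<Longrightarrow> y x \<in> K" "\<And>x. x \<in> K \<Longrightarrow> r x > 0"
    "\<And>x z. x \<in> K \<Longrightarrow> z \<in> K \<Longrightarrow> dist z x < r x \<Longrightarrow> f z < f (y x)" by metis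
  have "K \<subseteq> (\<Union>x\<in>K. ball x (r x))" using y by force
  then obtain T where T: "T \<subseteq> K" "finite T" "K \<subseteq> (\<Union>x\<in>T. ball x (r x))"
    using compactE_image[OF \<open>compact K\<close>, of K "\<lambda>x. ball x (r x)"] by auto
  with \<open>K \<noteq> {}\<close> have "T \<noteq> {}" by auto
  have "Max ((\<lambda>x. f (y x)) ` T) \<in> (\<lambda>x. f (y x)) ` T"
    using T(2) \<open>T \<noteq> {}\<close> by (intro Max_in) auto
  then obtain x where x: "x \<in> T" "f (y x) = Max ((\<lambda>x. f (y x)) ` T)" by (metis imageE)
  then have x: "x \<in> T" "\<forall>z\<in>T. f (y z) \<le> f (y x)" using T(2) by auto
  then have "y x \<in> K" using T y(1) by auto
  then obtain z where "z \<in> T" "dist (y x) z < r z" using T(3) by (auto simp: dist_commute)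
  then have "f (y x) < f (y z)" using \<open>y x \<in> K\<close> y(3)[of z "y x"] T by auto
  then show False using x \<open>z \<in> T\<close> by force
qed

lemma usc_on_diff_continuous:
  fixes f g :: "'a::metric_space \<Rightarrow> real"
  assumes "usc_on S f" "continuous_on S g"
  shows "usc_on S (\<lambda>x. f x - g x)"
  unfolding usc_on_iff
proof (intro ballI allI impI)
  fix x c assume x: "x \<in> S" and c: "f x - g x < c"
  define e where "e = (c - (f x - g x)) / 2"
  have "e > 0" using c by (simp add: e_def)
  obtain r where r: "r > 0" "\<forall>y\<in>S. dist y x < r \<longrightarrow> f y < f x + e"
    using assms(1)[unfolded usc_on_iff, rule_format, OF x, of "f x + e"] \<open>e > 0\<close> by auto
  obtain s where s: "s > 0" "\<forall>y\<in>S. dist y x < s \<longrightarrow> dist (g y) (g x) < e"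
    using assms(2) x \<open>e > 0\<close> unfolding continuous_on_iff by blast
  have "f y - g y < c" if "y \<in> S" "dist y x < min r s" for y
  proof -
    have "f y < f x + e" "\<bar>g y - g x\<bar> < e" using r s that by (auto simp: dist_real_def)
    moreover have "c = (f x - g x) + 2 * e" by (simp add: e_def field_simps)
    ultimately show ?thesis by linarith
  qed
  then show "\<exists>r>0. \<forall>y\<in>S. dist y x < r \<longrightarrow> f y - g y < c"
    using r s by (intro exI[of _ "min r s"]) auto
qed

lemma lsc_on_diff_continuous:
  fixes f g :: "'a::metric_space \<Rightarrow> real"
  assumes "lsc_on S f" "continuous_on S g"
  shows "lsc_on S (\<lambda>x. f x - g x)"
  using usc_on_diff_continuous[of S "\<lambda>x. - f x" "\<lambda>x. - g x"] assms
  by (simp add: usc_on_iff_lsc_on_uminus continuous_on_minus)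

section \<open>The half-Laplacian\<close>

text \<open>Jordan's inequality: sine is concave on \<open>{0..pi}\<close> and so lies above its
  chord from 0 to \<open>pi / 2\<close>. It bounds the singular kernel by a multiple of the inverse
  square.\<close>

lemma sin_squared_ge:
  assumes "\<bar>y\<bar> \<le> pi"
  shows "y\<^sup>2 / pi\<^sup>2 \<le> (sin (y / 2))\<^sup>2"
proof -
  have cvx: "convex_on {0..pi} (\<lambda>x. - sin x)"
    by (rule f''_ge0_imp_convex[where f' = "\<lambda>x. - cos x" and f'' = sin])
      (auto intro!: derivative_eq_intros sin_ge_zero)
  define s where "s = \<bar>y\<bar> / pi"
  have s: "0 \<le> s" "s \<le> 1" using assms by (auto simp: s_def field_simps)
  have "s \<le> sin (s * (pi / 2))"
    using convex_onD[OF cvx, of s 0 "pi / 2"] s by simp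
  then have "s\<^sup>2 \<le> (sin (\<bar>y\<bar> / 2))\<^sup>2"
    using s by (intro power_mono) (auto simp: s_def)
  moreover have "(sin (\<bar>y\<bar> / 2))\<^sup>2 = (sin (y / 2))\<^sup>2" by (cases "y \<ge> 0") auto
  ultimately show ?thesis by (simp add: s_def power_divide)
qed

text \<open>The constant is a parameter because dominated convergence needs one Lipschitz constant
  for a whole sequence.\<close>

definition C11_with :: "real \<Rightarrow> (real \<Rightarrow> real) \<Rightarrow> bool" where
  "C11_with L f \<longleftrightarrow> (\<exists>f'. (\<forall>x. (f has_real_derivative f' x) (at x)) \<and> L-lipschitz_on UNIV f')"

lemma C11_with_continuous: "C11_with L f \<Longrightarrow> continuous_on A f"
  unfolding C11_with_def by (meson DERIV_continuous continuous_at_imp_continuous_on)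

text \<open>Mean value theorem for the second difference as a function of the step: its derivative
  compares \<open>f'\<close> at two points at most \<open>2 * y\<close> apart.\<close>

lemma second_difference_bound:
  assumes "C11_with L f"
  shows "\<bar>2 * f \<theta> - f (\<theta> - y) - f (\<theta> + y)\<bar> \<le> 2 * L * y\<^sup>2"
proof -
  obtain f' where f': "\<And>x. (f has_real_derivative f' x) (at x)" "L-lipschitz_on UNIV f'"
    using assms unfolding C11_with_def by blast
  have pos: "\<bar>2 * f \<theta> - f (\<theta> - y) - f (\<theta> + y)\<bar> \<le> 2 * L * y\<^sup>2" if "y > 0" for y
  proof -
    define k where "k = (\<lambda>s. 2 * f \<theta> - f (\<theta> - s) - f (\<theta> + s))"
    have "(k has_real_derivative f' (\<theta> - s) - f' (\<theta> + s)) (at s)" for s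
      unfolding k_def
      by (auto intro!: derivative_eq_intros DERIV_chain2[where f = f] f')
    then obtain z where z: "0 < z" "z < y" "k y - k 0 = (y - 0) * (f' (\<theta> - z) - f' (\<theta> + z))"
      using MVT2[OF \<open>0 < y\<close>, of k "\<lambda>s. f' (\<theta> - s) - f' (\<theta> + s)"] by blast
    have L: "L \<ge> 0" using f'(2) lipschitz_on_nonneg by blast
    have "\<bar>f' (\<theta> - z) - f' (\<theta> + z)\<bar> \<le> L * \<bar>(\<theta> - z) - (\<theta> + z)\<bar>"
      using lipschitz_onD[OF f'(2), of "\<theta> - z" "\<theta> + z"] by (simp add: dist_real_def)
    also have "\<dots> \<le> L * (2 * y)" using z L by (intro mult_left_mono) auto
    finally have "\<bar>f' (\<theta> - z) - f' (\<theta> + z)\<bar> * y \<le> L * (2 * y) * y"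
      using that by (intro mult_right_mono) auto
    moreover have "k y = y * (f' (\<theta> - z) - f' (\<theta> + z))" using z by (simp add: k_def)
    ultimately show ?thesis using that by (simp add: k_def abs_mult power2_eq_square mult_ac)
  qed
  consider "y > 0" | "y = 0" | "y < 0" by linarith
  then show ?thesis
    by cases (use pos[of y] pos[of "- y"] in \<open>auto simp: algebra_simps\<close>)
qed

abbreviation half_laplacian_integrand :: "(real \<Rightarrow> real) \<Rightarrow> real \<Rightarrow> real \<Rightarrow> real" where
  "half_laplacian_integrand f \<theta> y \<equiv> (2 * f \<theta> - f (\<theta> - y) - f (\<theta> + y)) / (sin (y / 2))\<^sup>2"

text \<open>The quadratic decay of the second difference cancels the singularity. The bound depends
  on \<open>L\<close> alone, so it dominates uniformly in \<open>\<theta>\<close>; at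
  \<open>y = 0\<close> the integrand is 0 by the convention for division.\<close>

lemma half_laplacian_integrand_bound:
  assumes "C11_with L f" "\<bar>y\<bar> \<le> pi"
  shows "\<bar>half_laplacian_integrand f \<theta> y\<bar> \<le> 2 * L * pi\<^sup>2"
proof -
  have L: "L \<ge> 0" using assms lipschitz_on_nonneg unfolding C11_with_def by blast
  show ?thesis
  proof (cases "y = 0")
    case False
    then have *: "0 < y\<^sup>2 / pi\<^sup>2" by simp
    with sin_squared_ge[OF assms(2)] have "0 < (sin (y / 2))\<^sup>2" by linarith
    then have "\<bar>half_laplacian_integrand f \<theta> y\<bar> \<le> 2 * L * y\<^sup>2 / (sin (y / 2))\<^sup>2"
      using second_difference_bound[OF assms(1), of \<theta> y]
      by (simp add: abs_divide divide_right_mono)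
    also have "\<dots> \<le> 2 * L * y\<^sup>2 / (y\<^sup>2 / pi\<^sup>2)"
      using sin_squared_ge[OF assms(2)] * L \<open>0 < (sin (y / 2))\<^sup>2\<close>
      by (intro divide_left_mono mult_pos_pos) auto
    also have "\<dots> = 2 * L * pi\<^sup>2" using False by simp
    finally show ?thesis .
  qed (use L in simp)
qed

lemma half_laplacian_integrand_measurable:
  assumes "C11_with L f"
  shows "half_laplacian_integrand f \<theta> \<in> borel_measurable lborel"
proof -
  have "continuous_on UNIV (\<lambda>y. 2 * f \<theta> - f (\<theta> - y) - f (\<theta> + y))"
    by (intro continuous_intros continuous_on_compose2[OF C11_with_continuous[OF assms, of UNIV]]) auto
  then have "(\<lambda>y. 2 * f \<theta> - f (\<theta> - y) - f (\<theta> + y)) \<in> borel_measurable borel"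
    by (rule borel_measurable_continuous_onI)
  then show ?thesis by measurable
qed

lemma half_laplacian_integrable:
  assumes "C11_with L f"
  shows "set_integrable lborel {-pi..pi} (half_laplacian_integrand f \<theta>)"
  unfolding set_integrable_def
proof (rule Bochner_Integration.integrable_bound)
  show "integrable lborel (\<lambda>y. indicator {-pi..pi} y *\<^sub>R (2 * L * pi\<^sup>2))"
    by (intro integrable_scaleR_left) (auto simp: integrable_indicator_iff)
  show "(\<lambda>y. indicator {-pi..pi} y *\<^sub>R half_laplacian_integrand f \<theta> y) \<in> borel_measurable lborel"
    using half_laplacian_integrand_measurable[OF assms, of \<theta>] by measurable
  show "AE y in lborel. norm (indicator {-pi..pi} y *\<^sub>R half_laplacian_integrand f \<theta> y)
      \<le> norm (indicator {-pi..pi} y *\<^sub>R (2 * L * pi\<^sup>2))"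
  proof (intro AE_I2)
    fix y
    show "norm (indicator {-pi..pi} y *\<^sub>R half_laplacian_integrand f \<theta> y)
        \<le> norm (indicator {-pi..pi} y *\<^sub>R (2 * L * pi\<^sup>2))"
      using half_laplacian_integrand_bound[OF assms, of y \<theta>] abs_ge_self[of "2 * L * pi\<^sup>2"]
      by (cases "y \<in> {-pi..pi}") (simp_all add: abs_le_iff)
  qed
qed

text \<open>Dominated convergence with moving function and moving base point; the common constant
  \<open>L\<close> provides the dominating function.\<close>

lemma half_laplacian_tendsto:
  fixes \<theta> :: "nat \<Rightarrow> real"
  assumes "\<And>n. C11_with L (f n)" "C11_with L g"
    and lim: "\<And>y. (\<lambda>n. f n (\<theta> n + y)) \<longlonglongrightarrow> g (\<tau> + y)"
  shows "(\<lambda>n. half_laplacian (f n) (\<theta> n)) \<longlonglongrightarrow> half_laplacian g \<tau>"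
  unfolding half_laplacian_def set_lebesgue_integral_def
proof (intro tendsto_mult tendsto_const
    integral_dominated_convergence[where w = "\<lambda>y. indicator {-pi..pi} y *\<^sub>R (2 * L * pi\<^sup>2)"])
  show "integrable lborel (\<lambda>y. indicator {-pi..pi} y *\<^sub>R (2 * L * pi\<^sup>2))"
    by (intro integrable_scaleR_left) (auto simp: integrable_indicator_iff)
  show "(\<lambda>y. indicator {-pi..pi} y *\<^sub>R half_laplacian_integrand g \<tau> y) \<in> borel_measurable lborel"
    using half_laplacian_integrand_measurable[OF assms(2), of \<tau>] by measurable
  show "(\<lambda>y. indicator {-pi..pi} y *\<^sub>R half_laplacian_integrand (f n) (\<theta> n) y)
      \<in> borel_measurable lborel" for n
    using half_laplacian_integrand_measurable[OF assms(1), of n "\<theta> n"] by measurable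
  show "AE y in lborel. norm (indicator {-pi..pi} y *\<^sub>R half_laplacian_integrand (f n) (\<theta> n) y)
      \<le> indicator {-pi..pi} y *\<^sub>R (2 * L * pi\<^sup>2)" for n
  proof (intro AE_I2)
    fix y
    show "norm (indicator {-pi..pi} y *\<^sub>R half_laplacian_integrand (f n) (\<theta> n) y)
        \<le> indicator {-pi..pi} y *\<^sub>R (2 * L * pi\<^sup>2)"
      using half_laplacian_integrand_bound[OF assms(1), of y n "\<theta> n"]
      by (cases "y \<in> {-pi..pi}") (simp_all add: abs_le_iff)
  qed
  have "(\<lambda>n. half_laplacian_integrand (f n) (\<theta> n) y) \<longlonglongrightarrow> half_laplacian_integrand g \<tau> y" for y
  \<comment> \<open>Where the sine vanishes, both integrands are 0 by the convention for
    division.\<close>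
  proof (cases "sin (y / 2) = 0")
    case False
    then show ?thesis
      using lim[of 0] lim[of y] lim[of "- y"] by (intro tendsto_intros) simp_all
  qed simp
  then show "AE y in lborel. (\<lambda>n. indicator {-pi..pi} y *\<^sub>R half_laplacian_integrand (f n) (\<theta> n) y)
      \<longlonglongrightarrow> indicator {-pi..pi} y *\<^sub>R half_laplacian_integrand g \<tau> y"
    by (intro AE_I2 tendsto_scaleR tendsto_const)
qed

text \<open>Ellipticity: the inequality reverses because the values away from
  \<open>\<theta>\<close> enter the second difference with a minus sign.\<close>

lemma half_laplacian_mono:
  assumes "C11_with L f" "C11_with M g" and "\<And>x. f x - f \<theta> \<le> g x - g \<theta>"
  shows "half_laplacian g \<theta> \<le> half_laplacian f \<theta>"
proof -
  have "half_laplacian_integrand g \<theta> y \<le> half_laplacian_integrand f \<theta> y" for y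
    using assms(3)[of "\<theta> - y"] assms(3)[of "\<theta> + y"] by (intro divide_right_mono) auto
  then show ?thesis
    unfolding half_laplacian_def
    by (intro mult_left_mono set_integral_mono half_laplacian_integrable[OF assms(1)]
        half_laplacian_integrable[OF assms(2)]) auto
qed

lemma half_laplacian_add_scaled:
  assumes "C11_with L f" "C11_with M g"
  shows "half_laplacian (\<lambda>x. f x + c * g x + d) \<theta> = half_laplacian f \<theta> + c * half_laplacian g \<theta>"
proof -
  have "half_laplacian_integrand (\<lambda>x. f x + c * g x + d) \<theta> y =
      half_laplacian_integrand f \<theta> y + c * half_laplacian_integrand g \<theta> y" for y
    by (simp add: diff_divide_distrib add_divide_distrib algebra_simps)
  then have "half_laplacian (\<lambda>x. f x + c * g x + d) \<theta> = 1 / (8 * pi) *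
      (LINT y:{-pi..pi}|lborel. half_laplacian_integrand f \<theta> y + c * half_laplacian_integrand g \<theta> y)"
    unfolding half_laplacian_def by simp
  also have "\<dots> = half_laplacian f \<theta> + c * half_laplacian g \<theta>"
    unfolding half_laplacian_def
    using set_integral_add(2)[OF half_laplacian_integrable[OF assms(1), of \<theta>]
        set_integrable_mult_right[of c, OF half_laplacian_integrable[OF assms(2), of \<theta>]]]
    by (simp only: set_integral_mult_right distrib_left mult.left_commute)
  finally show ?thesis .
qed

lemma half_laplacian_shift: "half_laplacian (\<lambda>x. f (x + h)) \<theta> = half_laplacian f (\<theta> + h)"
  unfolding half_laplacian_def by (simp add: algebra_simps)

section \<open>Test functions\<close>

lemma mem_spacetime [simp]: "(t, x) \<in> spacetime \<longleftrightarrow> t \<ge> 0"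
  by (simp add: spacetime_def)

text \<open>Stated for arbitrary coefficients \<open>a\<close> and \<open>b\<close>, since it serves
  to identify such coefficients with \<open>dt\<close> and \<open>dx\<close>.\<close>

lemma C1_spacetime_has_derivative_x:
  assumes "\<forall>p\<in>spacetime. (\<phi> has_derivative (\<lambda>(h, k). a p * h + b p * k)) (at p within spacetime)"
    and "t \<ge> 0"
  shows "((\<lambda>y. \<phi> (t, y)) has_real_derivative b (t, x)) (at x)"
proof -
  have "(\<phi> has_derivative (\<lambda>(h, k). a (t, x) * h + b (t, x) * k)) (at (t, x) within (Pair t ` UNIV))"
    by (rule has_derivative_subset[of _ _ _ spacetime]) (use assms in auto)
  moreover have "(Pair t has_derivative Pair 0) (at x)"
    by (auto intro!: derivative_eq_intros)
  ultimately have "(\<phi> \<circ> Pair t has_derivative (\<lambda>(h, k). a (t, x) * h + b (t, x) * k) \<circ> Pair 0) (at x)"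
    using diff_chain_within[of "Pair t" "Pair 0" x UNIV \<phi>] by simp
  then show ?thesis by (simp add: has_field_derivative_def comp_def mult_commute_abs)
qed

lemma C1_spacetime_has_derivative_t_within:
  assumes "\<forall>p\<in>spacetime. (\<phi> has_derivative (\<lambda>(h, k). a p * h + b p * k)) (at p within spacetime)"
    and "t \<ge> 0"
  shows "((\<lambda>s. \<phi> (s, x)) has_real_derivative a (t, x)) (at t within {0..})"
proof -
  let ?f = "\<lambda>s. (s, x)" and ?f' = "\<lambda>h::real. (h, 0::real)"
  have "(\<phi> has_derivative (\<lambda>(h, k). a (t, x) * h + b (t, x) * k)) (at (t, x) within (?f ` {0..}))"
    by (rule has_derivative_subset[of _ _ _ spacetime]) (use assms in auto)
  moreover have "(?f has_derivative ?f') (at t within {0..})"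
    by (auto intro!: derivative_eq_intros)
  ultimately have "(\<phi> \<circ> ?f has_derivative (\<lambda>(h, k). a (t, x) * h + b (t, x) * k) \<circ> ?f') (at t within {0..})"
    using diff_chain_within[of ?f ?f' t "{0..}" \<phi>] by simp
  then show ?thesis by (simp add: has_field_derivative_def comp_def mult_commute_abs)
qed

lemma spacetime_derivatives_unique:
  assumes "\<forall>p\<in>spacetime. (\<phi> has_derivative (\<lambda>(h, k). a p * h + b p * k)) (at p within spacetime)"
    and "p \<in> spacetime"
  shows "dt \<phi> p = a p" "dx \<phi> p = b p"
proof -
  obtain t x where p: "p = (t, x)" "t \<ge> 0" using assms(2) by (cases p) auto
  show "dx \<phi> p = b p"
    using C1_spacetime_has_derivative_x[OF assms(1) p(2)] by (simp add: dx_def p DERIV_imp_deriv)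
  \<comment> \<open>Points to the right of \<open>t\<close> keep the filter nontrivial even at
    \<open>t = 0\<close>; this makes the one-sided derivative unique.\<close>
  have "{t<..} \<subseteq> {0..}" using p(2) by auto
  from at_le[OF this, of t] have "at t within {0..} \<noteq> bot"
    by (metis trivial_limit_at_right_real le_bot)
  then show "dt \<phi> p = a p"
    using C1_spacetime_has_derivative_t_within[OF assms(1) p(2)]
    by (simp add: dt_def p vector_derivative_within has_real_derivative_iff_has_vector_derivative)
qed

lemma test_functionI:
  assumes "\<forall>p\<in>spacetime. (\<phi> has_derivative (\<lambda>(h, k). a p * h + b p * k)) (at p within spacetime)"
    and "continuous_on spacetime a" "L-lipschitz_on spacetime b" "periodic_increment \<phi>"
  shows "test_function \<phi>"
proof -
  note * = spacetime_derivatives_unique[OF assms(1)]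
  have "L-lipschitz_on spacetime (dx \<phi>)"
    using assms(3) * by (auto simp: lipschitz_on_def)
  moreover from this have "continuous_on spacetime (dx \<phi>)" by (rule lipschitz_on_continuous_on)
  moreover have "continuous_on spacetime (dt \<phi>)"
    using assms(2) * continuous_on_cong[of spacetime spacetime "dt \<phi>" a] by simp
  ultimately show ?thesis
    using assms(1,4) * unfolding test_function_def C1_spacetime_def by auto
qed

context
  fixes \<phi> assumes \<phi>: "test_function \<phi>"
begin

lemma test_function_has_derivative:
  "\<forall>p\<in>spacetime. (\<phi> has_derivative (\<lambda>(h, k). dt \<phi> p * h + dx \<phi> p * k)) (at p within spacetime)"
  using \<phi> unfolding test_function_def C1_spacetime_def by blast

lemma test_function_continuous_on: "continuous_on spacetime \<phi>"
  by (rule has_derivative_continuous_on[OF test_function_has_derivative[rule_format]])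

lemma test_function_DERIV_x:
  "t \<ge> 0 \<Longrightarrow> ((\<lambda>y. \<phi> (t, y)) has_real_derivative dx \<phi> (t, x)) (at x)"
  by (rule C1_spacetime_has_derivative_x[OF test_function_has_derivative])

lemma test_function_DERIV_t:
  assumes "t > 0"
  shows "((\<lambda>s. \<phi> (s, x)) has_real_derivative dt \<phi> (t, x)) (at t)"
proof -
  have "((\<lambda>s. \<phi> (s, x)) has_real_derivative dt \<phi> (t, x)) (at t within {0..})"
    using assms by (intro C1_spacetime_has_derivative_t_within[OF test_function_has_derivative]) simp
  moreover have "at t within {0..} = at t" by (rule at_within_interior) (use assms in simp)
  ultimately show ?thesis by simp
qed

text \<open>The constant comes from the joint Lipschitz bound on \<open>dx \<phi>\<close>, hence is
  uniform in time, as convergence along moving time slices requires.\<close>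

lemma test_function_C11: "\<exists>L. \<forall>t\<ge>0. C11_with L (\<lambda>x. \<phi> (t, x))"
proof -
  obtain L where L: "L-lipschitz_on spacetime (dx \<phi>)"
    using \<phi> unfolding test_function_def by blast
  have "C11_with L (\<lambda>x. \<phi> (t, x))" if "t \<ge> 0" for t
    unfolding C11_with_def
  proof (intro exI[of _ "\<lambda>x. dx \<phi> (t, x)"] conjI allI)
    show "L-lipschitz_on UNIV (\<lambda>x. dx \<phi> (t, x))"
    proof (rule lipschitz_onI)
      show "dist (dx \<phi> (t, x)) (dx \<phi> (t, y)) \<le> L * dist x y" for x y
        using lipschitz_onD[OF L, of "(t, x)" "(t, y)"] that by (simp add: dist_Pair_Pair)
    qed (use lipschitz_on_nonneg[OF L] in simp)
  qed (rule test_function_DERIV_x[OF that])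
  then show ?thesis by blast
qed

lemma half_laplacian_test_function_continuous:
  "continuous_on spacetime (\<lambda>(t, \<theta>). half_laplacian (\<lambda>x. \<phi> (t, x)) \<theta>)"
  unfolding continuous_on_sequentially
proof (intro allI ballI impI, elim conjE)
  fix u p assume p: "p \<in> spacetime" and u: "\<forall>n. u n \<in> spacetime" "u \<longlonglongrightarrow> p"
  obtain L where L: "\<And>t. t \<ge> 0 \<Longrightarrow> C11_with L (\<lambda>x. \<phi> (t, x))" using test_function_C11 by blast
  have pos: "fst (u n) \<ge> 0" "fst p \<ge> 0" for n
    using u(1) p by (auto simp: spacetime_def mem_Times_iff)
  have "(\<lambda>n. half_laplacian (\<lambda>x. \<phi> (fst (u n), x)) (snd (u n)))
      \<longlonglongrightarrow> half_laplacian (\<lambda>x. \<phi> (fst p, x)) (snd p)"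
  proof (rule half_laplacian_tendsto[OF L[OF pos(1)] L[OF pos(2)]])
    fix y
    have "(\<lambda>n. (fst (u n), snd (u n) + y)) \<longlonglongrightarrow> (fst p, snd p + y)"
      by (intro tendsto_intros u)
    then have "(\<phi> \<circ> (\<lambda>n. (fst (u n), snd (u n) + y))) \<longlonglongrightarrow> \<phi> (fst p, snd p + y)"
      using test_function_continuous_on[unfolded continuous_on_sequentially, rule_format,
          of "(fst p, snd p + y)" "\<lambda>n. (fst (u n), snd (u n) + y)"] pos by simp
    then show "(\<lambda>n. \<phi> (fst (u n), snd (u n) + y)) \<longlonglongrightarrow> \<phi> (fst p, snd p + y)"
      by (simp add: comp_def)
  qed
  then show "((\<lambda>(t, \<theta>). half_laplacian (\<lambda>x. \<phi> (t, x)) \<theta>) \<circ> u) \<longlonglongrightarrow>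
      (case p of (t, \<theta>) \<Rightarrow> half_laplacian (\<lambda>x. \<phi> (t, x)) \<theta>)"
    by (simp add: comp_def case_prod_unfold)
qed

text \<open>For positive \<open>dx \<phi> p\<close> the denominator stays away from 0. For negative
  \<open>dx \<phi> p\<close> the positive part vanishes nearby, and the quotient is constantly 0 by
  the convention for division.\<close>

lemma equation_lhs_continuous_at:
  assumes "p \<in> spacetime" "dx \<phi> p \<noteq> 0"
  shows "continuous (at p within spacetime) (equation_lhs \<phi>)"
proof -
  have cdx: "continuous_on spacetime (dx \<phi>)" and cdt: "continuous_on spacetime (dt \<phi>)"
    using \<phi> unfolding test_function_def C1_spacetime_def by blast+
  let ?q = "\<lambda>p. (case p of (t, \<theta>) \<Rightarrow> half_laplacian (\<lambda>x. \<phi> (t, x)) \<theta>) / max (dx \<phi> p) 0"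
  note within = cdx[unfolded continuous_on_eq_continuous_within, rule_format, OF assms(1)]
    cdt[unfolded continuous_on_eq_continuous_within, rule_format, OF assms(1)]
    half_laplacian_test_function_continuous[unfolded continuous_on_eq_continuous_within, rule_format, OF assms(1)]
  have "continuous (at p within spacetime) ?q"
  proof (cases "dx \<phi> p > 0")
    case True
    then show ?thesis unfolding continuous_within
      by (intro tendsto_divide tendsto_max tendsto_const within[unfolded continuous_within]) auto
  next
    case False
    then have neg: "dx \<phi> p < 0" using assms(2) by simp
    then have "\<forall>\<^sub>F q in at p within spacetime. dx \<phi> q < 0"
      using within(1) by (auto simp: continuous_within intro: order_tendstoD)
    then have "\<forall>\<^sub>F q in at p within spacetime. ?q q = 0" by (rule eventually_mono) simp
    then have "(?q \<longlongrightarrow> 0) (at p within spacetime)" by (rule tendsto_eventually)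
    then show ?thesis using neg by (simp add: continuous_within)
  qed
  then have "continuous (at p within spacetime) (\<lambda>p. dt \<phi> p + 1 / pi * (arctan (?q p) + pi / 2))"
    by (intro continuous_add continuous_mult continuous_const continuous_arctan within)
  moreover have "equation_lhs \<phi> = (\<lambda>p. dt \<phi> p + 1 / pi * (arctan (?q p) + pi / 2))"
    by (auto simp: equation_lhs_def)
  ultimately show ?thesis by simp
qed

end

section \<open>Translation and perturbation of test functions\<close>

lemma test_function_shift:
  assumes \<phi>: "test_function \<phi>"
  shows "test_function (\<lambda>(t, x). \<phi> (t, x + h))"
proof -
  obtain L where L: "L-lipschitz_on spacetime (dx \<phi>)" using \<phi> unfolding test_function_def by blast
  let ?s = "\<lambda>(t::real, x::real). (t, x + h)"
  have s: "?s ` spacetime \<subseteq> spacetime" "continuous_on spacetime ?s"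
    by (auto simp: spacetime_def case_prod_unfold intro!: continuous_intros)
  have "((\<lambda>(t, x). \<phi> (t, x + h)) has_derivative (\<lambda>(a, b). dt \<phi> (?s p) * a + dx \<phi> (?s p) * b))
      (at p within spacetime)" if "p \<in> spacetime" for p
  proof -
    have "(?s has_derivative id) (at p within spacetime)"
      by (auto intro!: derivative_eq_intros simp: case_prod_unfold id_def)
    moreover have "(\<phi> has_derivative (\<lambda>(a, b). dt \<phi> (?s p) * a + dx \<phi> (?s p) * b)) (at (?s p) within ?s ` spacetime)"
      using test_function_has_derivative[OF \<phi>, rule_format, of "?s p"] that s(1)
      by (intro has_derivative_subset[OF _ s(1)]) auto
    ultimately show ?thesis using diff_chain_within[of ?s id p spacetime \<phi>]
      by (simp add: comp_def case_prod_unfold)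
  qed
  moreover have "continuous_on spacetime (\<lambda>p. dt \<phi> (?s p))"
    using \<phi> s unfolding test_function_def C1_spacetime_def
    by (intro continuous_on_compose2[of spacetime "dt \<phi>" spacetime ?s]) auto
  moreover have "L-lipschitz_on spacetime (\<lambda>p. dx \<phi> (?s p))"
  proof (rule lipschitz_onI)
    fix p q assume "p \<in> spacetime" "q \<in> spacetime"
    moreover have "dist (?s p) (?s q) = dist p q" by (simp add: case_prod_unfold dist_prod_def)
    ultimately show "dist (dx \<phi> (?s p)) (dx \<phi> (?s q)) \<le> L * dist p q"
      using lipschitz_onD[OF L, of "?s p" "?s q"] s(1) by auto
  qed (use lipschitz_on_nonneg[OF L] in simp)
  moreover have "periodic_increment (\<lambda>(t, x). \<phi> (t, x + h))"
  proof -
    obtain a where a: "\<And>t x. t \<ge> 0 \<Longrightarrow> \<phi> (t, x + 2 * pi) = \<phi> (t, x) + a"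
      using \<phi> unfolding test_function_def periodic_increment_def by blast
    have "\<phi> (t, x + 2 * pi + h) = \<phi> (t, x + h) + a" if "t \<ge> 0" for t x
      using a[OF that, of "x + h"] by (simp add: algebra_simps)
    then show ?thesis unfolding periodic_increment_def by auto
  qed
  ultimately show ?thesis by (intro test_functionI) auto
qed

lemma DERIV_shift_arg: "deriv (\<lambda>y. f (y + h)) x = deriv f (x + h :: real)"
  unfolding deriv_def DERIV_shift ..

lemma shift_derivatives:
  "dt (\<lambda>(t, x). \<phi> (t, x + h)) (t, x) = dt \<phi> (t, x + h)"
  "dx (\<lambda>(t, x). \<phi> (t, x + h)) (t, x) = dx \<phi> (t, x + h)"
  by (simp_all add: dt_def dx_def DERIV_shift_arg[of "\<lambda>y. \<phi> (t, y)"])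

lemma equation_lhs_shift:
  "equation_lhs (\<lambda>(t, x). \<phi> (t, x + h)) (t, x) = equation_lhs \<phi> (t, x + h)"
  by (simp add: equation_lhs_def shift_derivatives half_laplacian_shift[of "\<lambda>x. \<phi> (t, x)"])

text \<open>The perturbation makes a maximum strict, modulo the period, and coercive in time.\<close>

definition perturb :: "(real \<times> real \<Rightarrow> real) \<Rightarrow> real \<Rightarrow> real \<Rightarrow> real \<Rightarrow> real \<Rightarrow> real \<times> real \<Rightarrow> real" where
  "perturb \<phi> \<eta> \<kappa> t1 \<theta>1 = (\<lambda>(t, x). \<phi> (t, x) + \<eta> * (t - t1)\<^sup>2 + \<kappa> * (1 - cos (x - \<theta>1)))"

lemma perturb_has_derivative:
  assumes "test_function \<phi>" "p \<in> spacetime"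
  shows "(perturb \<phi> \<eta> \<kappa> t1 \<theta>1 has_derivative
    (\<lambda>(h, k). (dt \<phi> p + 2 * \<eta> * (fst p - t1)) * h + (dx \<phi> p + \<kappa> * sin (snd p - \<theta>1)) * k))
    (at p within spacetime)"
proof -
  have "perturb \<phi> \<eta> \<kappa> t1 \<theta>1 = (\<lambda>p. \<phi> p + \<eta> * (fst p - t1)\<^sup>2 + \<kappa> * (1 - cos (snd p - \<theta>1)))"
    by (auto simp: perturb_def)
  then show ?thesis
    using test_function_has_derivative[OF assms(1), rule_format, OF assms(2)]
    by (auto intro!: derivative_eq_intros simp: case_prod_unfold algebra_simps)
qed

lemma lipschitz_on_sin: "1-lipschitz_on UNIV (sin :: real \<Rightarrow> real)"
proof (rule lipschitz_onI)
  show "dist (sin x) (sin y) \<le> 1 * dist x y" for x y :: real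
    using field_differentiable_bound[of UNIV sin cos 1 x y]
    by (auto simp: dist_norm norm_minus_commute intro!: DERIV_sin)
qed simp

text \<open>The quadratic term in time does not contribute to \<open>dx\<close>, the only derivative
  required to be Lipschitz, so its growth is harmless; the cosine term is periodic and keeps the
  increment.\<close>

lemma perturb_test_function:
  assumes \<phi>: "test_function \<phi>"
  shows "test_function (perturb \<phi> \<eta> \<kappa> t1 \<theta>1)"
proof -
  obtain L where L: "L-lipschitz_on spacetime (dx \<phi>)" using \<phi> unfolding test_function_def by blast
  have "(\<bar>\<kappa>\<bar> * (1 * 1))-lipschitz_on spacetime (\<lambda>p. \<kappa> * sin (snd p - \<theta>1))"
  proof (intro lipschitz_on_cmult_real lipschitz_on_compose2[where g = sin])
    show "1-lipschitz_on spacetime (\<lambda>p. snd p - \<theta>1)"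
    proof (rule lipschitz_onI)
      show "dist (snd p - \<theta>1) (snd q - \<theta>1) \<le> 1 * dist p q" for p q :: "real \<times> real"
        using dist_snd_le[of p q] by (simp add: dist_real_def)
    qed simp
  qed (auto intro: lipschitz_on_subset[OF lipschitz_on_sin])
  then have "(L + \<bar>\<kappa>\<bar> * (1 * 1))-lipschitz_on spacetime (\<lambda>p. dx \<phi> p + \<kappa> * sin (snd p - \<theta>1))"
    using L by (intro lipschitz_on_add)
  moreover have "continuous_on spacetime (\<lambda>p. dt \<phi> p + 2 * \<eta> * (fst p - t1))"
    using \<phi> unfolding test_function_def C1_spacetime_def by (intro continuous_intros) auto
  moreover have "periodic_increment (perturb \<phi> \<eta> \<kappa> t1 \<theta>1)"
  proof -
    have "cos (x + 2 * pi - \<theta>1) = cos (x - \<theta>1)" for x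
      using cos_periodic[of "x - \<theta>1"] by (simp add: algebra_simps)
    then show ?thesis
      using \<phi> unfolding test_function_def periodic_increment_def perturb_def by auto
  qed
  ultimately show ?thesis
    using perturb_has_derivative[OF \<phi>] by (intro test_functionI) auto
qed

lemma perturb_derivatives:
  assumes "test_function \<phi>" "t \<ge> 0"
  shows "dt (perturb \<phi> \<eta> \<kappa> t1 \<theta>1) (t, x) = dt \<phi> (t, x) + 2 * \<eta> * (t - t1)"
    and "dx (perturb \<phi> \<eta> \<kappa> t1 \<theta>1) (t, x) = dx \<phi> (t, x) + \<kappa> * sin (x - \<theta>1)"
  using spacetime_derivatives_unique[of "perturb \<phi> \<eta> \<kappa> t1 \<theta>1"
      "\<lambda>p. dt \<phi> p + 2 * \<eta> * (fst p - t1)" "\<lambda>p. dx \<phi> p + \<kappa> * sin (snd p - \<theta>1)" "(t, x)"]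
    perturb_has_derivative[OF assms(1)] assms(2) by auto

lemma C11_with_one_minus_cos: "C11_with 1 (\<lambda>x. 1 - cos (x - \<theta>1))"
  unfolding C11_with_def
proof (intro exI conjI allI)
  show "((\<lambda>x. 1 - cos (x - \<theta>1)) has_real_derivative sin (x - \<theta>1)) (at x)" for x
    by (auto intro!: derivative_eq_intros)
  have "(1 * 1)-lipschitz_on UNIV (\<lambda>x. sin (x - \<theta>1))"
  proof (rule lipschitz_on_compose2[where g = sin])
    show "1-lipschitz_on UNIV (\<lambda>x. x - \<theta>1)"
      by (rule lipschitz_onI) (simp_all add: dist_real_def)
  qed (rule lipschitz_on_subset[OF lipschitz_on_sin], simp)
  then show "1-lipschitz_on UNIV (\<lambda>x. sin (x - \<theta>1))" by simp
qed

text \<open>The time penalty is constant on each slice and drops out; linearity handles the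
  rest.\<close>

lemma perturb_half_laplacian:
  assumes "test_function \<phi>" "t \<ge> 0"
  shows "half_laplacian (\<lambda>x. perturb \<phi> \<eta> \<kappa> t1 \<theta>1 (t, x)) \<theta> =
    half_laplacian (\<lambda>x. \<phi> (t, x)) \<theta> + \<kappa> * half_laplacian (\<lambda>x. 1 - cos (x - \<theta>1)) \<theta>"
proof -
  obtain L where "C11_with L (\<lambda>x. \<phi> (t, x))" using test_function_C11 assms by blast
  from half_laplacian_add_scaled[OF this C11_with_one_minus_cos]
  have "half_laplacian (\<lambda>x. \<phi> (t, x) + \<kappa> * (1 - cos (x - \<theta>1)) + \<eta> * (t - t1)\<^sup>2) \<theta> =
    half_laplacian (\<lambda>x. \<phi> (t, x)) \<theta> + \<kappa> * half_laplacian (\<lambda>x. 1 - cos (x - \<theta>1)) \<theta>" .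
  then show ?thesis by (simp add: perturb_def add.commute add.left_commute)
qed

section \<open>Reduction to one period\<close>

text \<open>The increment is fixed to the total mass 1, so that suprema and envelopes inherit it and
  differences of two such functions are periodic.\<close>

definition unit_increment :: "(real \<times> real \<Rightarrow> real) \<Rightarrow> bool" where
  "unit_increment u \<longleftrightarrow> (\<forall>t\<ge>0. \<forall>x. u (t, x + 2 * pi) = u (t, x) + 1)"

lemma unit_increment_of_int:
  assumes "unit_increment u" "t \<ge> 0"
  shows "u (t, x + 2 * pi * of_int k) = u (t, x) + of_int k"
proof (induction k rule: int_induct[where k = 0])
  case (step1 i)
  have "u (t, (x + 2 * pi * of_int i) + 2 * pi) = u (t, x + 2 * pi * of_int i) + 1"
    using assms unfolding unit_increment_def by blast
  then show ?case using step1 by (simp add: algebra_simps)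
next
  case (step2 i)
  have "u (t, (x + 2 * pi * of_int (i - 1)) + 2 * pi) = u (t, x + 2 * pi * of_int (i - 1)) + 1"
    using assms unfolding unit_increment_def by blast
  then show ?case using step2 by (simp add: algebra_simps)
qed simp

lemma exists_period_representative: "\<exists>k::int. \<bar>x + 2 * pi * of_int k - \<theta>\<bar> \<le> pi"
proof -
  define y where "y = (\<theta> - x) / (2 * pi)"
  have "\<bar>of_int (round y) - y\<bar> * (2 * pi) \<le> 1 / 2 * (2 * pi)"
    by (intro mult_right_mono of_int_round_abs_le) simp
  also have "\<bar>of_int (round y) - y\<bar> * (2 * pi) = \<bar>(of_int (round y) - y) * (2 * pi)\<bar>"
    by (simp add: abs_mult)
  also have "(of_int (round y) - y) * (2 * pi) = x + 2 * pi * of_int (round y) - \<theta>"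
    by (simp add: y_def field_simps)
  finally show ?thesis by auto
qed

text \<open>If \<open>\<phi>\<close> has increment \<open>a\<close>, moving by one period forwards
  or backwards changes the difference by \<open>1 - a\<close> or its negative; an extremum forces
  both to have the same sign, so \<open>a = 1\<close>. One time slice is enough because
  \<open>a\<close> is common to all times.\<close>

lemma contact_unit_increment:
  assumes u: "unit_increment u" and \<phi>: "test_function \<phi>" and t: "t \<ge> 0"
    and "(\<forall>x. u (t, x) - \<phi> (t, x) \<le> u (t, \<theta>) - \<phi> (t, \<theta>)) \<or>
      (\<forall>x. u (t, \<theta>) - \<phi> (t, \<theta>) \<le> u (t, x) - \<phi> (t, x))"
  shows "unit_increment \<phi>"
proof -
  obtain a where a: "\<And>t x. t \<ge> 0 \<Longrightarrow> \<phi> (t, x + 2 * pi) = \<phi> (t, x) + a"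
    using \<phi> unfolding test_function_def periodic_increment_def by blast
  have u': "u (t, x + 2 * pi) = u (t, x) + 1" for x
    using u t unfolding unit_increment_def by blast
  define d where "d x = u (t, x) - \<phi> (t, x)" for x
  have "d (\<theta> - 2 * pi) \<le> d \<theta> \<and> d (\<theta> + 2 * pi) \<le> d \<theta> \<or> d \<theta> \<le> d (\<theta> - 2 * pi) \<and> d \<theta> \<le> d (\<theta> + 2 * pi)"
    using assms(4) by (auto simp: d_def)
  moreover have "d (\<theta> + 2 * pi) = d \<theta> + (1 - a)" "d (\<theta> - 2 * pi) = d \<theta> - (1 - a)"
    using a[OF t, of \<theta>] a[OF t, of "\<theta> - 2 * pi"] u'[of \<theta>] u'[of "\<theta> - 2 * pi"]
    by (simp_all add: d_def)
  ultimately have "a = 1" by linarith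
  with a show ?thesis by (simp add: unit_increment_def)
qed

lemma add_const_derivatives:
  assumes \<phi>: "test_function \<phi>" and eq: "\<And>t x. t \<ge> 0 \<Longrightarrow> \<psi> (t, x) = \<phi> (t, x) + c" and t: "t \<ge> 0"
  shows "dx \<psi> (t, x) = dx \<phi> (t, x)" "equation_lhs \<psi> (t, x) = equation_lhs \<phi> (t, x)"
proof -
  have "(\<psi> has_derivative (\<lambda>(h, k). dt \<phi> p * h + dx \<phi> p * k)) (at p within spacetime)"
    if p: "p \<in> spacetime" for p
  proof (rule has_derivative_transform[OF p])
    show "\<psi> q = \<phi> q + c" if "q \<in> spacetime" for q using that eq by (cases q) auto
    show "((\<lambda>q. \<phi> q + c) has_derivative (\<lambda>(h, k). dt \<phi> p * h + dx \<phi> p * k)) (at p within spacetime)"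
      using test_function_has_derivative[OF \<phi>, rule_format, OF p] by (rule has_derivative_add_const)
  qed
  note * = spacetime_derivatives_unique[of \<psi> "dt \<phi>" "dx \<phi>" "(t, x)"]
  have d: "dt \<psi> (t, x) = dt \<phi> (t, x)" "dx \<psi> (t, x) = dx \<phi> (t, x)"
    using * \<open>\<And>p. p \<in> spacetime \<Longrightarrow> _\<close> t by auto
  have "half_laplacian (\<lambda>x. \<psi> (t, x)) x = half_laplacian (\<lambda>x. \<phi> (t, x)) x"
    unfolding half_laplacian_def using eq[OF t] by (simp add: algebra_simps)
  with d show "dx \<psi> (t, x) = dx \<phi> (t, x)" "equation_lhs \<psi> (t, x) = equation_lhs \<phi> (t, x)"
    by (simp_all add: equation_lhs_def)
qed

text \<open>The translate by \<open>k\<close> periods is also the function plus a constant;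
  computing its derivatives both ways gives periodicity.\<close>

lemma unit_increment_derivatives:
  assumes "test_function \<phi>" "unit_increment \<phi>" "t \<ge> 0"
  shows "dx \<phi> (t, x + 2 * pi * of_int k) = dx \<phi> (t, x)"
    and "equation_lhs \<phi> (t, x + 2 * pi * of_int k) = equation_lhs \<phi> (t, x)"
proof -
  define \<psi> where "\<psi> = (\<lambda>(t, x). \<phi> (t, x + 2 * pi * of_int k))"
  have "\<psi> (t, x) = \<phi> (t, x) + of_int k" if "t \<ge> 0" for t x
    using unit_increment_of_int[OF assms(2) that] by (simp add: \<psi>_def)
  from add_const_derivatives[OF assms(1) this assms(3), of x]
  show "dx \<phi> (t, x + 2 * pi * of_int k) = dx \<phi> (t, x)"
    and "equation_lhs \<phi> (t, x + 2 * pi * of_int k) = equation_lhs \<phi> (t, x)"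
    by (simp_all add: \<psi>_def shift_derivatives equation_lhs_shift)
qed

section \<open>Non-strict contact and the gap around a strict maximum\<close>

text \<open>Adding \<open>\<eta>\<close> times a penalty that vanishes exactly at the periodic
  images of the contact point makes the maximum strict; then \<open>\<eta>\<close> tends to
  0.\<close>

lemma subsolution_at_max:
  assumes u: "viscosity_subsolution u" and \<phi>: "test_function \<phi>" and t: "t > 0"
    and max: "\<And>p. p \<in> spacetime \<Longrightarrow> u p - \<phi> p \<le> u (t, \<theta>) - \<phi> (t, \<theta>)"
    and dx: "dx \<phi> (t, \<theta>) \<noteq> 0"
  shows "equation_lhs \<phi> (t, \<theta>) \<le> 0"
proof -
  define A where "A = half_laplacian (\<lambda>x. \<phi> (t, x)) \<theta>"
  define B where "B = half_laplacian (\<lambda>x. 1 - cos (x - \<theta>)) \<theta>"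
  \<comment> \<open>The value of \<open>equation_lhs\<close> at the contact point after
    perturbation: both first derivatives of the penalty vanish there, and only the half-Laplacian
    changes, by \<open>\<eta> * B\<close>.\<close>
  define q where "q \<eta> = dt \<phi> (t, \<theta>) + 1 / pi * (arctan ((A + \<eta> * B) / max (dx \<phi> (t, \<theta>)) 0) + pi / 2)"
    for \<eta>
  have "q \<eta> \<le> 0" if \<eta>: "\<eta> > 0" for \<eta>
  proof -
    let ?\<psi> = "perturb \<phi> \<eta> \<eta> t \<theta>"
    have at: "?\<psi> (t, \<theta>) = \<phi> (t, \<theta>)" by (simp add: perturb_def)
    have le: "u (s, x) - ?\<psi> (s, x) \<le> u (t, \<theta>) - ?\<psi> (t, \<theta>) - \<eta> * ((s - t)\<^sup>2 + (1 - cos (x - \<theta>)))"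
      if "s \<ge> 0" for s x
      using max[of "(s, x)"] that unfolding at by (simp add: perturb_def algebra_simps)
    have nn: "0 \<le> (s - t)\<^sup>2 + (1 - cos (x - \<theta>))" for s x by simp
    have "strict_max_at (\<lambda>p. u p - ?\<psi> p) t \<theta>"
      unfolding strict_max_at_def
    proof (intro conjI ballI impI)
      fix p assume "p \<in> spacetime"
      then obtain s x where p: "p = (s, x)" "s \<ge> 0" by (cases p) auto
      have "0 \<le> \<eta> * ((s - t)\<^sup>2 + (1 - cos (x - \<theta>)))" using nn[of s x] \<eta> by simp
      then show "u p - ?\<psi> p \<le> u (t, \<theta>) - ?\<psi> (t, \<theta>)" using le[OF p(2), of x] p by simp
      assume "u p - ?\<psi> p = u (t, \<theta>) - ?\<psi> (t, \<theta>)"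
      then have "\<eta> * ((s - t)\<^sup>2 + (1 - cos (x - \<theta>))) \<le> 0" using le[OF p(2), of x] p by simp
      then have "(s - t)\<^sup>2 + (1 - cos (x - \<theta>)) \<le> 0" using \<eta> by (simp add: mult_le_0_iff)
      then have "(s - t)\<^sup>2 = 0" "cos (x - \<theta>) = 1"
        using zero_le_power2[of "s - t"] cos_le_one[of "x - \<theta>"] by linarith+
      then obtain k :: int where "s = t" "x - \<theta> = of_int k * 2 * pi" by (auto simp: cos_one_2pi_int)
      then have "p = (t, \<theta> + 2 * pi * of_int k)" using p by (simp add: algebra_simps)
      then show "\<exists>k::int. p = (t, \<theta> + 2 * pi * of_int k)" ..
    qed
    moreover have d: "dx ?\<psi> (t, \<theta>) = dx \<phi> (t, \<theta>)" "dt ?\<psi> (t, \<theta>) = dt \<phi> (t, \<theta>)"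
      using perturb_derivatives[OF \<phi>, of t] t by simp_all
    ultimately have "equation_lhs ?\<psi> (t, \<theta>) \<le> 0"
      using u perturb_test_function[OF \<phi>] t dx unfolding viscosity_subsolution_def by metis
    moreover have "half_laplacian (\<lambda>x. ?\<psi> (t, x)) \<theta> = A + \<eta> * B"
      using perturb_half_laplacian[OF \<phi>, of t] t by (simp add: A_def B_def)
    then have "equation_lhs ?\<psi> (t, \<theta>) = q \<eta>"
      using d by (simp add: equation_lhs_def q_def)
    ultimately show ?thesis by simp
  qed
  then have ev: "\<forall>\<^sub>F \<eta> in at_right 0. q \<eta> \<le> 0" by (simp add: eventually_at_filter)
  have "(q \<longlongrightarrow> q 0) (at_right 0)"
  \<comment> \<open>A vanishing denominator makes \<open>q\<close> constant, by the convention for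
    division.\<close>
  proof (cases "max (dx \<phi> (t, \<theta>)) 0 = 0")
    case False
    then show ?thesis unfolding q_def by (intro tendsto_intros)
  qed (simp add: q_def[abs_def])
  then have "q 0 \<le> 0" using ev by (rule tendsto_upperbound) simp
  then show ?thesis by (simp add: q_def A_def equation_lhs_def)
qed

text \<open>One period of the time slab minus the open box is compact, so the maximum of
  \<open>g\<close> on it is attained; strictness excludes equality with the peak. The condition
  \<open>\<rho> < t0\<close> keeps the slab in \<open>spacetime\<close>.\<close>

lemma strict_max_gap:
  assumes "usc_on spacetime g" "strict_max_at g t0 \<theta>0" "0 < \<rho>" "\<rho> < t0"
  shows "\<exists>\<delta>>0. \<forall>t x. \<bar>t - t0\<bar> \<le> \<rho> \<and> \<bar>x - \<theta>0\<bar> \<le> pi \<and> \<not> (\<bar>t - t0\<bar> < \<rho> \<and> \<bar>x - \<theta>0\<bar> < \<rho>) \<longrightarrow>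
    g (t, x) \<le> g (t0, \<theta>0) - \<delta>"
proof -
  define K where "K = {t0 - \<rho>..t0 + \<rho>} \<times> {\<theta>0 - pi..\<theta>0 + pi} -
    {t0 - \<rho><..<t0 + \<rho>} \<times> {\<theta>0 - \<rho><..<\<theta>0 + \<rho>}"
  have K: "(t, x) \<in> K \<longleftrightarrow>
      \<bar>t - t0\<bar> \<le> \<rho> \<and> \<bar>x - \<theta>0\<bar> \<le> pi \<and> \<not> (\<bar>t - t0\<bar> < \<rho> \<and> \<bar>x - \<theta>0\<bar> < \<rho>)" for t x
    by (auto simp: K_def)
  have "compact K" unfolding K_def
    by (intro compact_diff compact_Times open_Times) auto
  moreover have "K \<subseteq> spacetime" using assms(4) by (auto simp: K)
  moreover have "(t0 + \<rho>, \<theta>0) \<in> K" using assms(3) by (simp add: K)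
  ultimately obtain q where q: "q \<in> K" "\<And>p. p \<in> K \<Longrightarrow> g p \<le> g q"
    using usc_on_attains_max[OF assms(1), of K] by blast
  have "g q \<noteq> g (t0, \<theta>0)"
  proof
    assume "g q = g (t0, \<theta>0)"
    then obtain k :: int where k: "q = (t0, \<theta>0 + 2 * pi * of_int k)"
      using assms(2) q \<open>K \<subseteq> spacetime\<close> unfolding strict_max_at_def by blast
    \<comment> \<open>A nonzero multiple of the period would leave the interval of radius
      \<open>pi\<close> around \<open>\<theta>0\<close>.\<close>
    then have "\<bar>2 * pi * of_int k\<bar> \<le> 1 * pi" using q by (simp add: K)
    then have "\<bar>real_of_int k\<bar> < 1" using pi_gt_zero
      by (simp only: abs_mult) (simp add: field_simps)
    then have "k = 0" by linarith
    then show False using q k assms(3) by (simp add: K)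
  qed
  moreover have "g q \<le> g (t0, \<theta>0)"
    using assms(2) q \<open>K \<subseteq> spacetime\<close> unfolding strict_max_at_def by blast
  ultimately show ?thesis
    using q(2) by (intro exI[of _ "g (t0, \<theta>0) - g q"]) (auto simp: K)
qed

lemma continuous_within_less:
  fixes f :: "'a::metric_space \<Rightarrow> real"
  assumes "continuous (at p within S) f" "c < f p"
  shows "\<exists>r>0. \<forall>q\<in>S. dist q p < r \<longrightarrow> c < f q"
proof -
  obtain r where "r > 0" "\<forall>q\<in>S. dist q p < r \<longrightarrow> dist (f q) (f p) < f p - c"
    using assms unfolding continuous_within_eps_delta by (metis diff_gt_0_iff_gt)
  then show ?thesis by (intro exI[of _ r]) (auto simp: dist_real_def)
qed

text \<open>The distance is at most the sum \<open>2 * \<rho>\<close> of the coordinate bounds; the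
  factor 3 makes the inequality strict and explains the division by 3 in later choices of
  \<open>\<rho>\<close>.\<close>

lemma dist_box_less:
  fixes t x :: real
  assumes "\<bar>t - t0\<bar> \<le> \<rho>" "\<bar>x - \<theta>0\<bar> \<le> \<rho>" "\<rho> > 0"
  shows "dist (t, x) (t0, \<theta>0) < 3 * \<rho>"
  using sqrt_sum_squares_le_sum_abs[of "t - t0" "x - \<theta>0"] assms
  by (simp add: dist_Pair_Pair dist_real_def)

lemma dist_Pair_lessD:
  fixes t x :: real
  assumes "dist (t, x) (t0, \<theta>0) < \<rho>"
  shows "\<bar>t - t0\<bar> < \<rho>" "\<bar>x - \<theta>0\<bar> < \<rho>"
  using dist_fst_le[of "(t, x)" "(t0, \<theta>0)"] dist_snd_le[of "(t, x)" "(t0, \<theta>0)"] assms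
  by (auto simp: dist_real_def)

section \<open>The Perron solution\<close>

text \<open>The bound by \<open>G\<close>, imposed at \<open>t = 0\<close> as well, is the only
  trace of the initial datum in the class.\<close>

definition subsolutions_below :: "(real \<Rightarrow> real) \<Rightarrow> (real \<times> real \<Rightarrow> real) set" where
  "subsolutions_below G =
    {u. viscosity_subsolution u \<and> unit_increment u \<and> (\<forall>t\<ge>0. \<forall>x. u (t, x) \<le> G x)}"

definition perron_sup :: "(real \<Rightarrow> real) \<Rightarrow> real \<times> real \<Rightarrow> real" where
  "perron_sup G p = (SUP u\<in>subsolutions_below G. u p)"

text \<open>A pointwise supremum of upper semicontinuous functions need not be upper semicontinuous,
  whereas a subsolution has to be.\<close>

definition perron_solution :: "(real \<Rightarrow> real) \<Rightarrow> real \<times> real \<Rightarrow> real" where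
  "perron_solution G = upper_envelope spacetime (perron_sup G)"

lemma unit_increment_imp_periodic: "unit_increment u \<Longrightarrow> periodic_increment u"
  unfolding unit_increment_def periodic_increment_def by blast

lemma spacetime_shift [simp]: "p + (0, h) \<in> spacetime \<longleftrightarrow> p \<in> spacetime"
  by (cases p) simp

lemma unit_increment_shift:
  assumes "unit_increment f" "p \<in> spacetime"
  shows "f (p + (0, 2 * pi)) = f p + 1" "f (p + (0, - 2 * pi)) = f p + - 1"
proof -
  have *: "f (q + (0, 2 * pi)) = f q + 1" if "q \<in> spacetime" for q
    using that assms(1) by (cases q) (simp add: unit_increment_def)
  show "f (p + (0, 2 * pi)) = f p + 1" by (rule *[OF assms(2)])
  show "f (p + (0, - 2 * pi)) = f p + - 1"
    using *[of "p + (0, - 2 * pi)"] assms(2) by (simp add: add.assoc flip: zero_prod_def)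
qed

lemma unit_increment_upper_envelope:
  assumes "locally_bounded_on spacetime f" "unit_increment f"
  shows "unit_increment (upper_envelope spacetime f)" (is "unit_increment ?H")
  unfolding unit_increment_def
proof (intro allI impI antisym)
  fix t x :: real assume t: "t \<ge> 0"
  have "?H (t, x) + 1 \<le> ?H ((t, x) + (0, 2 * pi))"
    by (rule upper_envelope_shift[OF assms(1)]) (use t unit_increment_shift[OF assms(2)] in auto)
  then show "?H (t, x) + 1 \<le> ?H (t, x + 2 * pi)" by simp
  have "?H (t, x + 2 * pi) + - 1 \<le> ?H ((t, x + 2 * pi) + (0, - 2 * pi))"
  proof (rule upper_envelope_shift[OF assms(1)])
    show "f p + - 1 \<le> f (p + (0, - 2 * pi))" if "p \<in> spacetime" for p
      using unit_increment_shift(2)[OF assms(2) that] by simp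
  qed (use t in simp_all)
  then show "?H (t, x + 2 * pi) \<le> ?H (t, x) + 1" by simp
qed

lemma unit_increment_lower_envelope:
  assumes "locally_bounded_on spacetime f" "unit_increment f"
  shows "unit_increment (lower_envelope spacetime f)" (is "unit_increment ?H")
  unfolding unit_increment_def
proof (intro allI impI antisym)
  fix t x :: real assume t: "t \<ge> 0"
  have "?H (t, x) + 1 \<le> ?H ((t, x) + (0, 2 * pi))"
    by (rule lower_envelope_shift[OF assms(1)]) (use t unit_increment_shift[OF assms(2)] in auto)
  then show "?H (t, x) + 1 \<le> ?H (t, x + 2 * pi)" by simp
  have "?H (t, x + 2 * pi) + - 1 \<le> ?H ((t, x + 2 * pi) + (0, - 2 * pi))"
  proof (rule lower_envelope_shift[OF assms(1)])
    show "f p + - 1 \<le> f (p + (0, - 2 * pi))" if "p \<in> spacetime" for p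
      using unit_increment_shift(2)[OF assms(2) that] by simp
  qed (use t in simp_all)
  then show "?H (t, x + 2 * pi) \<le> ?H (t, x) + 1" by simp
qed

section \<open>Barriers and first bounds\<close>

text \<open>The Perron construction sees the measure only through these properties of the
  barrier.\<close>

locale perron_barrier =
  fixes G :: "real \<Rightarrow> real" and m :: real
  assumes usc: "usc_on UNIV G"
    and increment: "G (x + 2 * pi) = G x + 1"
    and slope: "h \<ge> 0 \<Longrightarrow> G x + m * h \<le> G (x + h)"
    and m_nonneg: "m \<ge> 0"
begin

lemma G_mono:
  assumes "x \<le> y"
  shows "G x \<le> G y"
proof -
  have "0 \<le> m * (y - x)" using m_nonneg assms by simp
  then show ?thesis using slope[of "y - x" x] assms by simp
qed

text \<open>At a maximum, varying time alone gives \<open>dt \<phi> = -1\<close>, which absorbs an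
  arctangent term of at most 1. Membership also makes the class nonempty, as a supremum in the reals
  requires.\<close>

lemma lower_barrier_subsolution: "(\<lambda>(t, x). G x - t) \<in> subsolutions_below G"
proof -
  let ?L = "\<lambda>(t::real, x). G x - t"
  have "usc_on spacetime (G \<circ> snd)"
    unfolding usc_on_iff
  proof (intro ballI allI impI)
    fix p :: "real \<times> real" and c assume "(G \<circ> snd) p < c"
    then obtain r where "r > 0" "\<And>y. dist y (snd p) < r \<Longrightarrow> G y < c"
      using usc unfolding usc_on_iff by force
    then show "\<exists>r>0. \<forall>q\<in>spacetime. dist q p < r \<longrightarrow> (G \<circ> snd) q < c"
      by (intro exI[of _ r]) (auto intro: le_less_trans[OF dist_snd_le])
  qed
  then have "usc_on spacetime (\<lambda>p. (G \<circ> snd) p - fst p)"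
    by (rule usc_on_diff_continuous) (intro continuous_intros)
  then have u: "usc_on spacetime ?L" by (simp add: case_prod_unfold)
  have inc: "unit_increment ?L" by (simp add: unit_increment_def increment)
  have "equation_lhs \<phi> (t0, \<theta>0) \<le> 0"
    if \<phi>: "test_function \<phi>" "t0 > 0" "strict_max_at (\<lambda>p. ?L p - \<phi> p) t0 \<theta>0" for \<phi> t0 \<theta>0
  proof -
    have "((\<lambda>s. - s - \<phi> (s, \<theta>0)) has_real_derivative - 1 - dt \<phi> (t0, \<theta>0)) (at t0)"
      using test_function_DERIV_t[OF \<phi>(1,2)] by (auto intro!: derivative_eq_intros)
    moreover have "- s - \<phi> (s, \<theta>0) \<le> - t0 - \<phi> (t0, \<theta>0)" if "s \<ge> 0" for s
      using \<phi>(3) that unfolding strict_max_at_def by (auto dest!: bspec[of _ _ "(s, \<theta>0)"])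
    \<comment> \<open>The radius \<open>t0\<close> keeps the neighbourhood in nonnegative
      times.\<close>
    ultimately have "- 1 - dt \<phi> (t0, \<theta>0) = 0"
      using \<phi>(2) by (intro DERIV_local_max[where d = t0]) auto
    then have "dt \<phi> (t0, \<theta>0) = - 1" by simp
    moreover have "1 / pi * (arctan y + pi / 2) \<le> 1 / pi * (pi / 2 + pi / 2)" for y
      using arctan_ubound[of y] by (intro mult_left_mono add_right_mono) auto
    then have "1 / pi * (arctan y + pi / 2) \<le> 1" for y by simp
    ultimately show ?thesis unfolding equation_lhs_def prod.case by (metis add_left_mono add.left_inverse)
  qed
  then show ?thesis using u inc unit_increment_imp_periodic[OF inc]
    by (auto simp: subsolutions_below_def viscosity_subsolution_def)
qed

lemma perron_sup_ge:
  assumes "u \<in> subsolutions_below G" "p \<in> spacetime"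
  shows "u p \<le> perron_sup G p"
  unfolding perron_sup_def
proof (rule cSUP_upper[OF assms(1)])
  show "bdd_above ((\<lambda>u. u p) ` subsolutions_below G)"
    using assms(2) by (cases p) (auto simp: subsolutions_below_def intro!: bdd_aboveI[of _ "G (snd p)"])
qed

lemma perron_sup_leI:
  assumes "\<And>u. u \<in> subsolutions_below G \<Longrightarrow> u p \<le> c"
  shows "perron_sup G p \<le> c"
  unfolding perron_sup_def using lower_barrier_subsolution assms by (intro cSUP_least) auto

lemma between_barriers_locally_bounded:
  assumes "\<And>t x. t \<ge> 0 \<Longrightarrow> G x - t \<le> f (t, x)" "\<And>t x. t \<ge> 0 \<Longrightarrow> f (t, x) \<le> G x"
  shows "locally_bounded_on spacetime f"
proof (rule locally_bounded_onI)
  fix p :: "real \<times> real" assume "p \<in> spacetime"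
  obtain t x where p: "p = (t, x)" by fastforce
  have "G (x - 1) - (t + 1) \<le> f q \<and> f q \<le> G (x + 1)" if q: "q \<in> spacetime" "dist q p < 1" for q
  proof -
    obtain s y where sy: "q = (s, y)" "s \<ge> 0" using q(1) by (cases q) auto
    have "\<bar>s - t\<bar> < 1" "\<bar>y - x\<bar> < 1" using dist_Pair_lessD q(2) sy p by blast+
    then have "s \<le> t + 1" "G (x - 1) \<le> G y" "G y \<le> G (x + 1)" by (auto intro: G_mono)
    then show ?thesis using assms[OF sy(2), of y] sy by simp
  qed
  then show "\<exists>r>0. \<exists>a b. \<forall>q\<in>spacetime. dist q p < r \<longrightarrow> a \<le> f q \<and> f q \<le> b"
    by (metis zero_less_one)
qed

lemma perron_sup_bounds:
  assumes "t \<ge> 0"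
  shows "G x - t \<le> perron_sup G (t, x)" "perron_sup G (t, x) \<le> G x"
  using perron_sup_ge[OF lower_barrier_subsolution, of "(t, x)"] assms
  by (auto intro!: perron_sup_leI simp: subsolutions_below_def)

lemma locally_bounded_perron_sup: "locally_bounded_on spacetime (perron_sup G)"
  by (rule between_barriers_locally_bounded) (rule perron_sup_bounds, assumption)+

lemma perron_sup_le_solution: "p \<in> spacetime \<Longrightarrow> perron_sup G p \<le> perron_solution G p"
  unfolding perron_solution_def by (rule upper_envelope_ge[OF locally_bounded_perron_sup])

lemma perron_solution_ge: "u \<in> subsolutions_below G \<Longrightarrow> p \<in> spacetime \<Longrightarrow> u p \<le> perron_solution G p"
  using perron_sup_ge perron_sup_le_solution order_trans by blast

text \<open>Upper semicontinuity of \<open>G\<close> prevents the envelope from crossing the upper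
  barrier.\<close>

lemma perron_solution_bounds:
  assumes "t \<ge> 0"
  shows "G x - t \<le> perron_solution G (t, x)" "perron_solution G (t, x) \<le> G x"
proof -
  show "G x - t \<le> perron_solution G (t, x)"
    using perron_sup_bounds(1)[OF assms] perron_sup_le_solution[of "(t, x)"] assms
    by (force intro: order_trans)
  show "perron_solution G (t, x) \<le> G x"
  proof (rule dense_ge)
    fix c assume "G x < c"
    then obtain r where r: "r > 0" "\<And>y. dist y x < r \<Longrightarrow> G y < c"
      using usc unfolding usc_on_iff by force
    show "perron_solution G (t, x) \<le> c"
      unfolding perron_solution_def
    proof (rule upper_envelope_leI[OF locally_bounded_perron_sup _ r(1)])
      fix q :: "real \<times> real" assume q: "q \<in> spacetime" "dist q (t, x) < r"
      obtain s y where sy: "q = (s, y)" by fastforce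
      then have "G y < c" using r(2)[of y] dist_Pair_lessD[of s y t x r] q(2) by (simp add: dist_real_def)
      then show "perron_sup G q \<le> c" using perron_sup_bounds(2)[of s y] sy q(1) by simp
    next
      show "(t, x) \<in> spacetime" using assms by simp
    qed
  qed
qed

lemma locally_bounded_perron_solution: "locally_bounded_on spacetime (perron_solution G)"
  by (rule between_barriers_locally_bounded) (rule perron_solution_bounds, assumption)+

lemma unit_increment_perron_sup: "unit_increment (perron_sup G)"
  unfolding unit_increment_def
proof (intro allI impI antisym)
  fix t x :: real assume t: "t \<ge> 0"
  have inc: "u (t, x + 2 * pi) = u (t, x) + 1" if "u \<in> subsolutions_below G" for u
    using that t unfolding subsolutions_below_def unit_increment_def by blast
  show "perron_sup G (t, x + 2 * pi) \<le> perron_sup G (t, x) + 1"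
  proof (rule perron_sup_leI)
    show "u (t, x + 2 * pi) \<le> perron_sup G (t, x) + 1" if "u \<in> subsolutions_below G" for u
      using perron_sup_ge[OF that, of "(t, x)"] t inc[OF that] by simp
  qed
  have "perron_sup G (t, x) \<le> perron_sup G (t, x + 2 * pi) - 1"
  proof (rule perron_sup_leI)
    show "u (t, x) \<le> perron_sup G (t, x + 2 * pi) - 1" if "u \<in> subsolutions_below G" for u
      using perron_sup_ge[OF that, of "(t, x + 2 * pi)"] t inc[OF that] by simp
  qed
  then show "perron_sup G (t, x) + 1 \<le> perron_sup G (t, x + 2 * pi)" by simp
qed

lemma unit_increment_perron_solution: "unit_increment (perron_solution G)"
  unfolding perron_solution_def
  by (rule unit_increment_upper_envelope[OF locally_bounded_perron_sup unit_increment_perron_sup])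

text \<open>The quadratic penalisation in time forces a member of the class that is nearly optimal close
  to the contact point to attain its maximum relative to the test function there.\<close>

lemma perron_solution_subsolution_test:
  assumes \<phi>: "test_function \<phi>" and t0: "t0 > 0"
    and max: "strict_max_at (\<lambda>p. perron_solution G p - \<phi> p) t0 \<theta>0" and dx: "dx \<phi> (t0, \<theta>0) \<noteq> 0"
  shows "equation_lhs \<phi> (t0, \<theta>0) \<le> 0"
proof (rule ccontr)
  let ?F = "perron_solution G"
  assume pos: "\<not> equation_lhs \<phi> (t0, \<theta>0) \<le> 0"
  \<comment> \<open>A positive margin that persists near the contact point by continuity.\<close>
  define c where "c = equation_lhs \<phi> (t0, \<theta>0) / 2"
  have c: "0 < c" "c < equation_lhs \<phi> (t0, \<theta>0)" using pos by (auto simp: c_def)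
  have p0: "(t0, \<theta>0) \<in> spacetime" using t0 by simp
  define M where "M = ?F (t0, \<theta>0) - \<phi> (t0, \<theta>0)"
  have FM: "?F p - \<phi> p \<le> M" if "p \<in> spacetime" for p
    using max that unfolding strict_max_at_def M_def by blast
  have inc: "unit_increment \<phi>"
    by (rule contact_unit_increment[OF unit_increment_perron_solution \<phi>, of t0 \<theta>0])
      (use FM t0 in \<open>auto simp: M_def\<close>)
  obtain r1 where r1: "r1 > 0" "\<And>q. q \<in> spacetime \<Longrightarrow> dist q (t0, \<theta>0) < r1 \<Longrightarrow> c < equation_lhs \<phi> q"
    using continuous_within_less[OF equation_lhs_continuous_at[OF \<phi> p0 dx] c(2)] by blast
  have "continuous (at (t0, \<theta>0) within spacetime) (\<lambda>p. \<bar>dx \<phi> p\<bar>)"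
    using \<phi> p0 unfolding test_function_def C1_spacetime_def continuous_on_eq_continuous_within
    by (intro continuous_intros) blast
  then obtain r2 where r2: "r2 > 0" "\<And>q. q \<in> spacetime \<Longrightarrow> dist q (t0, \<theta>0) < r2 \<Longrightarrow> 0 < \<bar>dx \<phi> q\<bar>"
    using continuous_within_less[of "(t0, \<theta>0)" spacetime "\<lambda>p. \<bar>dx \<phi> p\<bar>" 0] dx by auto
  define \<rho> where "\<rho> = min (min r1 r2) t0 / 3"
  have \<rho>: "0 < \<rho>" "\<rho> < t0" "3 * \<rho> \<le> r1" "3 * \<rho> \<le> r2" using r1(1) r2(1) t0 by (auto simp: \<rho>_def)
  \<comment> \<open>On the box of radius \<open>\<rho>\<close> the time derivative of the penalty is
    at most \<open>2 * \<eta> * \<rho>\<close> in modulus, so this choice costs half of the margin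
    \<open>c\<close>.\<close>
  define \<eta> where "\<eta> = c / (4 * \<rho>)"
  have \<eta>: "\<eta> > 0" "2 * \<eta> * \<rho> = c / 2" using c \<rho> by (auto simp: \<eta>_def)
  define \<psi> where "\<psi> = perturb \<phi> \<eta> 0 t0 \<theta>0"
  have \<psi>_eq: "\<psi> (t, x) = \<phi> (t, x) + \<eta> * (t - t0)\<^sup>2" for t x by (simp add: \<psi>_def perturb_def)
  have \<psi>: "test_function \<psi>" unfolding \<psi>_def by (rule perturb_test_function[OF \<phi>])
  have \<psi>_dx: "dx \<psi> (t, x) = dx \<phi> (t, x)"
    and \<psi>_lhs: "equation_lhs \<psi> (t, x) = equation_lhs \<phi> (t, x) + 2 * \<eta> * (t - t0)" if "t \<ge> 0" for t x
    using perturb_derivatives[OF \<phi> that] perturb_half_laplacian[OF \<phi> that]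
    by (simp_all add: equation_lhs_def \<psi>_def)
  have inc\<psi>: "unit_increment \<psi>" using inc by (simp add: unit_increment_def \<psi>_eq)
  have usc_F: "usc_on spacetime (\<lambda>p. ?F p - \<phi> p)"
    unfolding perron_solution_def
    by (intro usc_on_diff_continuous usc_on_upper_envelope locally_bounded_perron_sup
        test_function_continuous_on[OF \<phi>])
  obtain \<delta>1 where \<delta>1: "\<delta>1 > 0" "\<And>t x. \<bar>t - t0\<bar> \<le> \<rho> \<Longrightarrow> \<bar>x - \<theta>0\<bar> \<le> pi \<Longrightarrow>
      \<not> (\<bar>t - t0\<bar> < \<rho> \<and> \<bar>x - \<theta>0\<bar> < \<rho>) \<Longrightarrow> ?F (t, x) - \<phi> (t, x) \<le> M - \<delta>1"
    using strict_max_gap[OF usc_F max \<rho>(1,2)] unfolding M_def by blast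
  \<comment> \<open>Two sources of a gap outside the box: \<open>\<delta>1\<close> from strictness
    within the time slab, and the penalty, at least \<open>\<eta> * \<rho>\<^sup>2\<close>, at all
    other times.\<close>
  define \<delta> where "\<delta> = min \<delta>1 (\<eta> * \<rho>\<^sup>2)"
  have \<delta>: "\<delta> > 0" using \<delta>1(1) \<eta>(1) \<rho>(1) by (simp add: \<delta>_def)
  have outside: "?F (t, x) - \<psi> (t, x) \<le> M - \<delta>"
    if "t \<ge> 0" "\<bar>x - \<theta>0\<bar> \<le> pi" "\<not> (\<bar>t - t0\<bar> < \<rho> \<and> \<bar>x - \<theta>0\<bar> < \<rho>)" for t x
  proof (cases "\<bar>t - t0\<bar> \<le> \<rho>")
    case True
    have "0 \<le> \<eta> * (t - t0)\<^sup>2" using \<eta>(1) by simp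
    then show ?thesis using \<delta>1(2)[OF True that(2,3)] by (simp add: \<psi>_eq \<delta>_def)
  next
    case False
    then have "\<rho>\<^sup>2 \<le> \<bar>t - t0\<bar>\<^sup>2" using \<rho>(1) by (intro power_mono) auto
    then have "\<eta> * \<rho>\<^sup>2 \<le> \<eta> * (t - t0)\<^sup>2" using \<eta>(1) by simp
    then show ?thesis using FM[of "(t, x)"] that(1) by (simp add: \<psi>_eq \<delta>_def)
  qed
  \<comment> \<open>The solution minus \<open>\<psi>\<close> equals \<open>M\<close> at the contact
    point and is an upper envelope there, so the supremum itself must come close to this value
    nearby.\<close>
  have "\<exists>y\<in>spacetime. dist y (t0, \<theta>0) < \<rho> \<and> perron_sup G y - \<psi> y > M - \<delta>"
  proof (rule ccontr)
    assume *: "\<not> ?thesis"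
    have "continuous (at (t0, \<theta>0) within spacetime) (\<lambda>p. - \<psi> p)"
      using test_function_continuous_on[OF \<psi>] p0 unfolding continuous_on_eq_continuous_within
      by (intro continuous_intros) blast
    then obtain r3 where r3: "r3 > 0"
      "\<And>q. q \<in> spacetime \<Longrightarrow> dist q (t0, \<theta>0) < r3 \<Longrightarrow> - \<psi> (t0, \<theta>0) - \<delta> / 2 < - \<psi> q"
      using continuous_within_less[of "(t0, \<theta>0)" spacetime "\<lambda>p. - \<psi> p" "- \<psi> (t0, \<theta>0) - \<delta> / 2"] \<delta>
      by auto
    have "?F (t0, \<theta>0) \<le> M - \<delta> + (\<psi> (t0, \<theta>0) + \<delta> / 2)"
      unfolding perron_solution_def
    proof (rule upper_envelope_leI[OF locally_bounded_perron_sup p0, of "min r3 \<rho>"])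
      fix y :: "real \<times> real" assume y: "y \<in> spacetime" "dist y (t0, \<theta>0) < min r3 \<rho>"
      then have "perron_sup G y - \<psi> y \<le> M - \<delta>" using * by force
      then show "perron_sup G y \<le> M - \<delta> + (\<psi> (t0, \<theta>0) + \<delta> / 2)" using r3(2)[of y] y by simp
    next
      show "0 < min r3 \<rho>" using r3(1) \<rho>(1) by simp
    qed
    then show False using \<delta> by (simp add: M_def \<psi>_eq)
  qed
  then obtain y where y: "y \<in> spacetime" "dist y (t0, \<theta>0) < \<rho>" "perron_sup G y > M - \<delta> + \<psi> y" by force
  then obtain u where u: "u \<in> subsolutions_below G" "u y > M - \<delta> + \<psi> y"
    using perron_sup_leI[of y "M - \<delta> + \<psi> y"] by force
  then have usub: "viscosity_subsolution u" and uinc: "unit_increment u"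
    by (auto simp: subsolutions_below_def)
  have uF: "u p \<le> ?F p" if "p \<in> spacetime" for p by (rule perron_solution_ge[OF u(1) that])
  define B where "B = {t0 - \<rho>..t0 + \<rho>} \<times> {\<theta>0 - \<rho>..\<theta>0 + \<rho>}"
  have yB: "y \<in> B"
  proof (cases y)
    case (Pair t x)
    then show ?thesis using y(2) dist_Pair_lessD[of t x t0 \<theta>0 \<rho>] by (simp add: B_def abs_less_iff)
  qed
  have "usc_on spacetime (\<lambda>p. u p - \<psi> p)"
    using usub test_function_continuous_on[OF \<psi>] unfolding viscosity_subsolution_def
    by (intro usc_on_diff_continuous) auto
  moreover have "compact B" unfolding B_def by (intro compact_Times) auto
  moreover have Bs: "B \<subseteq> spacetime" using \<rho> by (auto simp: B_def spacetime_def)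
  ultimately obtain p1 where p1: "p1 \<in> B" "\<And>p. p \<in> B \<Longrightarrow> u p - \<psi> p \<le> u p1 - \<psi> p1"
    using usc_on_attains_max[of spacetime "\<lambda>p. u p - \<psi> p" B] yB by blast
  obtain t1 \<theta>1 where p1_eq: "p1 = (t1, \<theta>1)" by fastforce
  have t1: "\<bar>t1 - t0\<bar> \<le> \<rho>" "\<bar>\<theta>1 - \<theta>0\<bar> \<le> \<rho>" using p1(1) by (auto simp: B_def p1_eq)
  \<comment> \<open>The maximum over the box is global: elsewhere, modulo the period,
    \<open>u - \<psi>\<close> is at most \<open>M - \<delta>\<close>, which its value at
    \<open>y\<close> in the box exceeds.\<close>
  have glob: "u p - \<psi> p \<le> u p1 - \<psi> p1" if "p \<in> spacetime" for p
  proof -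
    obtain t x where p: "p = (t, x)" "t \<ge> 0" using \<open>p \<in> spacetime\<close> by (cases p) auto
    obtain k :: int where k: "\<bar>x + 2 * pi * of_int k - \<theta>0\<bar> \<le> pi"
      using exists_period_representative by blast
    let ?x = "x + 2 * pi * of_int k"
    have "u p - \<psi> p = u (t, ?x) - \<psi> (t, ?x)"
      using unit_increment_of_int[OF uinc p(2)] unit_increment_of_int[OF inc\<psi> p(2)] p by simp
    also have "\<dots> \<le> u p1 - \<psi> p1"
    proof (cases "\<bar>t - t0\<bar> < \<rho> \<and> \<bar>?x - \<theta>0\<bar> < \<rho>")
      case True
      then show ?thesis by (intro p1(2)) (auto simp: B_def)
    next
      case False
      have "u (t, ?x) - \<psi> (t, ?x) \<le> M - \<delta>"
        using outside[OF p(2) k False] uF[of "(t, ?x)"] p(2) by simp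
      also have "\<dots> \<le> u y - \<psi> y" using u(2) by simp
      finally show ?thesis using p1(2)[OF yB] by simp
    qed
    finally show ?thesis .
  qed
  have close: "dist p1 (t0, \<theta>0) < 3 * \<rho>" using dist_box_less[OF t1 \<rho>(1)] p1_eq by simp
  have "equation_lhs \<psi> (t1, \<theta>1) \<le> 0"
  proof (rule subsolution_at_max[OF usub \<psi>])
    show "t1 > 0" using t1 \<rho> by linarith
    then show "dx \<psi> (t1, \<theta>1) \<noteq> 0"
      using r2(2)[of p1] close \<rho>(4) p1(1) Bs by (auto simp: \<psi>_dx p1_eq)
  qed (use glob p1_eq in auto)
  moreover have "equation_lhs \<psi> (t1, \<theta>1) = equation_lhs \<phi> (t1, \<theta>1) + 2 * \<eta> * (t1 - t0)"
    by (rule \<psi>_lhs) (use t1 \<rho> in linarith)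
  moreover have "c < equation_lhs \<phi> (t1, \<theta>1)"
    using r1(2)[of p1] close \<rho>(3) p1(1) Bs by (auto simp: p1_eq)
  \<comment> \<open>The penalty removes at most \<open>c / 2\<close>, so
    \<open>equation_lhs \<psi>\<close> stays above \<open>c / 2\<close>, a contradiction.\<close>
  moreover have "2 * \<eta> * (- \<rho>) \<le> 2 * \<eta> * (t1 - t0)" using \<eta>(1) t1 by (intro mult_left_mono) auto
  ultimately show False using \<eta>(2) c(1) by simp
qed

lemma perron_solution_mem: "perron_solution G \<in> subsolutions_below G"
  using perron_solution_subsolution_test unit_increment_perron_solution perron_solution_bounds
    unit_increment_imp_periodic[OF unit_increment_perron_solution]
    usc_on_upper_envelope[OF locally_bounded_perron_sup]
  unfolding subsolutions_below_def viscosity_subsolution_def perron_solution_def by blast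

section \<open>Maximality and the slope bound\<close>

text \<open>The equation is invariant under translation in space and addition of constants, and the
  slope of \<open>G\<close> pays for the added \<open>m * h\<close>.\<close>

lemma shifted_subsolution:
  assumes u: "u \<in> subsolutions_below G" and h: "h \<ge> 0"
  shows "(\<lambda>(t, x). u (t, x - h) + m * h) \<in> subsolutions_below G"
proof -
  let ?v = "\<lambda>(t, x). u (t, x - h) + m * h"
  have sub: "viscosity_subsolution u" and inc: "unit_increment u" and le: "\<And>t x. t \<ge> 0 \<Longrightarrow> u (t, x) \<le> G x"
    using u by (auto simp: subsolutions_below_def)
  have "usc_on spacetime ?v"
    unfolding usc_on_iff
  proof (intro ballI allI impI)
    fix p c assume p: "p \<in> spacetime" and c: "?v p < c"
    let ?s = "\<lambda>p. p + (0, - h)"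
    have v: "?v q = u (?s q) + m * h" for q by (cases q) simp
    have "u (?s p) < c - m * h" using c v by simp
    then obtain r where r: "r > 0" "\<And>q. q \<in> spacetime \<Longrightarrow> dist q (?s p) < r \<Longrightarrow> u q < c - m * h"
      using sub p unfolding viscosity_subsolution_def usc_on_iff by (meson spacetime_shift)
    have "?v q < c" if "q \<in> spacetime" "dist q p < r" for q
      using r(2)[of "?s q"] that unfolding v by simp
    then show "\<exists>r>0. \<forall>q\<in>spacetime. dist q p < r \<longrightarrow> ?v q < c" using r(1) by blast
  qed
  moreover have vinc: "unit_increment ?v"
    unfolding unit_increment_def
  proof (intro allI impI)
    fix t x :: real assume "t \<ge> 0"
    then have "u (t, (x - h) + 2 * pi) = u (t, x - h) + 1" using inc unfolding unit_increment_def by blast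
    then show "?v (t, x + 2 * pi) = ?v (t, x) + 1" by (simp add: algebra_simps)
  qed
  moreover have "?v (t, x) \<le> G x" if "t \<ge> 0" for t x
    using le[OF that, of "x - h"] slope[OF h, of "x - h"] by simp
  moreover have "equation_lhs \<phi> (t0, \<theta>0) \<le> 0"
    if \<phi>: "test_function \<phi>" "t0 > 0" "strict_max_at (\<lambda>p. ?v p - \<phi> p) t0 \<theta>0" "dx \<phi> (t0, \<theta>0) \<noteq> 0"
    for \<phi> t0 \<theta>0
  proof -
    let ?\<psi> = "\<lambda>(t, x). \<phi> (t, x + h)"
    have "equation_lhs ?\<psi> (t0, \<theta>0 - h) \<le> 0"
    proof (rule subsolution_at_max[OF sub test_function_shift[OF \<phi>(1)] \<phi>(2)])
      show "dx ?\<psi> (t0, \<theta>0 - h) \<noteq> 0" using \<phi>(4) by (simp add: shift_derivatives)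
      fix p assume "p \<in> spacetime"
      then obtain t x where p: "p = (t, x)" "t \<ge> 0" by (cases p) auto
      then have "?v (t, x + h) - \<phi> (t, x + h) \<le> ?v (t0, \<theta>0) - \<phi> (t0, \<theta>0)"
        using \<phi>(3) unfolding strict_max_at_def by (metis mem_spacetime)
      then show "u p - ?\<psi> p \<le> u (t0, \<theta>0 - h) - ?\<psi> (t0, \<theta>0 - h)" using p by simp
    qed
    then show ?thesis by (simp add: equation_lhs_shift)
  qed
  ultimately show ?thesis
    using unit_increment_imp_periodic[OF vinc]
    by (simp add: subsolutions_below_def viscosity_subsolution_def)
qed

text \<open>The shifted solution is itself a member of the class, hence lies below the solution at
  \<open>(t, x + h)\<close>.\<close>

lemma perron_solution_slope:
  assumes "t \<ge> 0" "h \<ge> 0"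
  shows "perron_solution G (t, x) + m * h \<le> perron_solution G (t, x + h)"
  using perron_solution_ge[OF shifted_subsolution[OF perron_solution_mem assms(2)], of "(t, x + h)"] assms(1)
  by simp

text \<open>If the test failed, then raising the solution to \<open>\<phi> + M + \<delta>\<close> near the contact point would
  give a larger subsolution. It stays below \<open>G\<close> unless the lower envelope already equals that of
  \<open>G\<close> at the contact point; but then \<open>dt \<phi>\<close> vanishes there and the inequality is trivial.\<close>

lemma perron_solution_supersolution_test:
  defines "H \<equiv> lower_envelope spacetime (perron_solution G)"
  assumes \<phi>: "test_function \<phi>" and t0: "t0 > 0"
    and min: "strict_min_at (\<lambda>p. H p - \<phi> p) t0 \<theta>0" and dx: "dx \<phi> (t0, \<theta>0) \<noteq> 0"
    and inc_H: "unit_increment H"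
  shows "equation_lhs \<phi> (t0, \<theta>0) \<ge> 0"
proof (rule ccontr)
  let ?F = "perron_solution G"
  assume "\<not> equation_lhs \<phi> (t0, \<theta>0) \<ge> 0"
  then have neg: "0 < - equation_lhs \<phi> (t0, \<theta>0)" by simp
  have p0: "(t0, \<theta>0) \<in> spacetime" using t0 by simp
  note H_le = lower_envelope_le[OF locally_bounded_perron_solution, folded H_def]
  note H_less = less_lower_envelopeD[OF locally_bounded_perron_solution, folded H_def]
  note le_H = le_lower_envelopeI[OF locally_bounded_perron_solution, folded H_def]
  define M where "M = H (t0, \<theta>0) - \<phi> (t0, \<theta>0)"
  have HM: "M \<le> H p - \<phi> p" if "p \<in> spacetime" for p
    using min that unfolding strict_min_at_def M_def by blast
  have inc: "unit_increment \<phi>"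
    by (rule contact_unit_increment[OF inc_H \<phi>, of t0 \<theta>0]) (use HM t0 in \<open>auto simp: M_def\<close>)
  \<comment> \<open>\<open>H\<close> inherits monotonicity in space from the solution, so
    \<open>\<phi>\<close>, touching it from below, cannot be strictly decreasing at the contact
    point.\<close>
  have dx_pos: "dx \<phi> (t0, \<theta>0) > 0"
  proof (rule ccontr)
    assume "\<not> dx \<phi> (t0, \<theta>0) > 0"
    then obtain d where d: "d > 0" "\<And>h. h > 0 \<Longrightarrow> h < d \<Longrightarrow> \<phi> (t0, \<theta>0) < \<phi> (t0, \<theta>0 - h)"
      using DERIV_neg_dec_left[OF test_function_DERIV_x[OF \<phi>, of t0 \<theta>0]] dx t0 by force
    have "?F q + 0 \<le> ?F (q + (0, d / 2))" if "q \<in> spacetime" for q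
    proof (cases q)
      case (Pair s y)
      have "0 \<le> m * (d / 2)" using m_nonneg d(1) by simp
      moreover have "?F (s, y) + m * (d / 2) \<le> ?F (s, y + d / 2)"
        using that d(1) Pair by (intro perron_solution_slope) auto
      ultimately show ?thesis unfolding Pair add_Pair by simp
    qed
    then have "H (t0, \<theta>0 - d / 2) + 0 \<le> H ((t0, \<theta>0 - d / 2) + (0, d / 2))"
      unfolding H_def using t0
      by (intro lower_envelope_shift[OF locally_bounded_perron_solution]) auto
    then show False using d(2)[of "d / 2"] d(1) HM[of "(t0, \<theta>0 - d / 2)"] t0 by (simp add: M_def)
  qed
  \<comment> \<open>Room below \<open>G\<close> for the raised function. If there were none, no
    \<open>H (t, \<theta>0)\<close> could exceed \<open>H (t0, \<theta>0)\<close>, because a larger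
    value bounds the solution, hence \<open>G\<close>, from below near \<open>\<theta>0\<close>;
    then \<open>\<phi>\<close> would be maximal in time at \<open>t0\<close>.\<close>
  have "\<exists>r>0. \<exists>b>H (t0, \<theta>0). \<forall>x. dist x \<theta>0 < r \<longrightarrow> b \<le> G x"
  proof (rule ccontr)
    assume *: "\<not> ?thesis"
    have "H (t, \<theta>0) \<le> H (t0, \<theta>0)" if t: "t \<ge> 0" for t
    proof (rule ccontr)
      assume "\<not> ?thesis"
      then obtain b where b: "H (t0, \<theta>0) < b" "b < H (t, \<theta>0)" using dense not_le by blast
      then obtain r where r: "r > 0" "\<And>q. q \<in> spacetime \<Longrightarrow> dist q (t, \<theta>0) < r \<Longrightarrow> b < ?F q"
        using H_less[of "(t, \<theta>0)" b] t by auto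
      have "b \<le> G x" if "dist x \<theta>0 < r" for x
        using r(2)[of "(t, x)"] that perron_solution_bounds(2)[OF t, of x] t
        by (simp add: dist_Pair_Pair)
      then show False using * r(1) b(1) by blast
    qed
    then have "\<phi> (t, \<theta>0) \<le> \<phi> (t0, \<theta>0)" if "t \<ge> 0" for t
      using that HM[of "(t, \<theta>0)"] by (force simp: M_def)
    then have "dt \<phi> (t0, \<theta>0) = 0"
      using t0 by (intro DERIV_local_max[OF test_function_DERIV_t[OF \<phi> t0], of t0]) auto
    moreover have "1 / pi * (arctan y + pi / 2) \<ge> 0" for y
      using arctan_lbound[of y] by (intro mult_nonneg_nonneg) auto
    ultimately have "equation_lhs \<phi> (t0, \<theta>0) \<ge> 0" unfolding equation_lhs_def by simp
    then show False using neg by simp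
  qed
  then obtain r0 b where r0: "r0 > 0" and b: "b > H (t0, \<theta>0)"
    and Gb: "\<And>x. \<bar>x - \<theta>0\<bar> < r0 \<Longrightarrow> b \<le> G x" by (auto simp: dist_real_def)
  \<comment> \<open>Half of the room: one \<open>e\<close> for the growth of \<open>\<phi>\<close>
    near the contact point, one for the lift \<open>\<delta>\<close>.\<close>
  define e where "e = (b - H (t0, \<theta>0)) / 2"
  have e: "e > 0" using b by (simp add: e_def)
  have "continuous (at (t0, \<theta>0) within spacetime) (\<lambda>p. - equation_lhs \<phi> p)"
    by (intro continuous_intros equation_lhs_continuous_at[OF \<phi> p0 dx])
  then obtain r1 where r1: "r1 > 0"
    "\<And>q. q \<in> spacetime \<Longrightarrow> dist q (t0, \<theta>0) < r1 \<Longrightarrow> equation_lhs \<phi> q < 0"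
    using continuous_within_less[of "(t0, \<theta>0)" spacetime "\<lambda>p. - equation_lhs \<phi> p" 0] neg by force
  have "continuous (at (t0, \<theta>0) within spacetime) (dx \<phi>)"
    using \<phi> p0 unfolding test_function_def C1_spacetime_def continuous_on_eq_continuous_within by blast
  then obtain r2 where r2: "r2 > 0" "\<And>q. q \<in> spacetime \<Longrightarrow> dist q (t0, \<theta>0) < r2 \<Longrightarrow> 0 < dx \<phi> q"
    using continuous_within_less[of "(t0, \<theta>0)" spacetime "dx \<phi>" 0] dx_pos by blast
  have c\<phi>: "continuous (at (t0, \<theta>0) within spacetime) \<phi>"
    using test_function_continuous_on[OF \<phi>] p0 unfolding continuous_on_eq_continuous_within by blast
  then have "continuous (at (t0, \<theta>0) within spacetime) (\<lambda>p. - \<phi> p)" by (rule continuous_minus)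
  from continuous_within_less[OF this, of "- \<phi> (t0, \<theta>0) - e"] e
  obtain r3 where r3: "r3 > 0"
    "\<And>q. q \<in> spacetime \<Longrightarrow> dist q (t0, \<theta>0) < r3 \<Longrightarrow> \<phi> q < \<phi> (t0, \<theta>0) + e" by force
  define \<rho> where "\<rho> = min (min (min r1 r2) (min r3 r0)) t0 / 3"
  have \<rho>: "0 < \<rho>" "\<rho> < t0" "3 * \<rho> \<le> r1" "3 * \<rho> \<le> r2" "3 * \<rho> \<le> r3" "\<rho> < r0"
    using r1(1) r2(1) r3(1) r0 t0 by (auto simp: \<rho>_def)
  have lsc: "lsc_on spacetime (\<lambda>p. H p - \<phi> p)"
    unfolding H_def
    by (intro lsc_on_diff_continuous lsc_on_lower_envelope locally_bounded_perron_solution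
        test_function_continuous_on[OF \<phi>])
  have usc: "usc_on spacetime (\<lambda>p. - (H p - \<phi> p))"
    unfolding usc_on_iff_lsc_on_uminus using lsc by simp
  have max: "strict_max_at (\<lambda>p. - (H p - \<phi> p)) t0 \<theta>0"
    using min unfolding strict_max_at_def strict_min_at_def
    by (simp only: neg_le_iff_le neg_equal_iff_equal)
  obtain \<delta>1 where \<delta>1: "\<delta>1 > 0" "\<And>t x. \<bar>t - t0\<bar> \<le> \<rho> \<Longrightarrow> \<bar>x - \<theta>0\<bar> \<le> pi \<Longrightarrow>
      \<not> (\<bar>t - t0\<bar> < \<rho> \<and> \<bar>x - \<theta>0\<bar> < \<rho>) \<Longrightarrow> M + \<delta>1 \<le> H (t, x) - \<phi> (t, x)"
    using strict_max_gap[OF usc max \<rho>(1,2)] unfolding M_def by (auto simp: algebra_simps)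
  \<comment> \<open>Halving makes \<open>\<delta> < \<delta>1\<close> strict, so the raised test
    function stays below \<open>H\<close> in the slab outside the box.\<close>
  define \<delta> where "\<delta> = min (\<delta>1 / 2) e"
  have \<delta>: "0 < \<delta>" "\<delta> < \<delta>1" "\<delta> \<le> e" using \<delta>1(1) e by (auto simp: \<delta>_def)
  define \<psi> where "\<psi> p = \<phi> p + (M + \<delta>)" for p
  have inc\<psi>: "unit_increment \<psi>" using inc by (simp add: unit_increment_def \<psi>_def)
  have inc_F: "unit_increment ?F" by (rule unit_increment_perron_solution)
  \<comment> \<open>The raised test function exceeds the solution only in periodic images of the
    open box; in particular never on the boundary of the slab.\<close>
  have small: "\<exists>k::int. \<bar>t - t0\<bar> < \<rho> \<and> \<bar>x + 2 * pi * of_int k - \<theta>0\<bar> < \<rho>"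
    if "\<bar>t - t0\<bar> \<le> \<rho>" "?F (t, x) < \<psi> (t, x)" for t x
  proof -
    have t: "t \<ge> 0" using that(1) \<rho> by linarith
    obtain k :: int where k: "\<bar>x + 2 * pi * of_int k - \<theta>0\<bar> \<le> pi"
      using exists_period_representative by blast
    let ?x = "x + 2 * pi * of_int k"
    have "?F (t, ?x) < \<psi> (t, ?x)"
      using that(2) unit_increment_of_int[OF inc_F t] unit_increment_of_int[OF inc\<psi> t] by simp
    then have "H (t, ?x) < \<psi> (t, ?x)" using H_le[of "(t, ?x)"] t by simp
    then have "\<not> M + \<delta>1 \<le> H (t, ?x) - \<phi> (t, ?x)" using \<delta> by (simp add: \<psi>_def)
    then show ?thesis using \<delta>1(2)[OF that(1) k] by blast
  qed
  \<comment> \<open>The maximum is taken at every position of the slab, not only in the box: thus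
    \<open>\<psi> \<le> w\<close> holds along whole time slices, as the nonlocal comparison below
    demands.\<close>
  define w where "w = (\<lambda>(t, x). if \<bar>t - t0\<bar> \<le> \<rho> then max (?F (t, x)) (\<psi> (t, x)) else ?F (t, x))"
  have Fw: "?F p \<le> w p" for p by (cases p) (auto simp: w_def)
  have sub_F: "viscosity_subsolution ?F" using perron_solution_mem by (simp add: subsolutions_below_def)
  have "usc_on spacetime w"
    unfolding usc_on_iff
  proof (intro ballI allI impI)
    fix p c assume p: "p \<in> spacetime" and c: "w p < c"
    obtain t x where tx: "p = (t, x)" by fastforce
    have "?F p < c" using c Fw[of p] by simp
    then obtain s1 where s1: "s1 > 0" "\<And>q. q \<in> spacetime \<Longrightarrow> dist q p < s1 \<Longrightarrow> ?F q < c"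
      using sub_F p unfolding viscosity_subsolution_def usc_on_iff by meson
    show "\<exists>r>0. \<forall>q\<in>spacetime. dist q p < r \<longrightarrow> w q < c"
    proof (cases "\<bar>t - t0\<bar> \<le> \<rho>")
      \<comment> \<open>Nearby points may lie outside the closed slab, but both the solution and
        \<open>\<psi>\<close> are below \<open>c\<close> there, so either branch of \<open>w\<close>
        is.\<close>
      case True
      then have "- c < - \<psi> p" using c by (simp add: w_def tx)
      moreover have "continuous (at p within spacetime) (\<lambda>p. - \<psi> p)"
        using test_function_continuous_on[OF \<phi>] p unfolding \<psi>_def continuous_on_eq_continuous_within
        by (intro continuous_intros) blast
      ultimately obtain s2 where s2: "s2 > 0" "\<And>q. q \<in> spacetime \<Longrightarrow> dist q p < s2 \<Longrightarrow> - c < - \<psi> q"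
        using continuous_within_less by blast
      have "w q < c" if "q \<in> spacetime" "dist q p < min s1 s2" for q
        using s1(2)[of q] s2(2)[of q] that by (cases q) (auto simp: w_def)
      then show ?thesis using s1(1) s2(1) by (intro exI[of _ "min s1 s2"]) auto
    next
      case False
      have "w q < c" if "q \<in> spacetime" "dist q p < min s1 (\<bar>t - t0\<bar> - \<rho>)" for q
      proof (cases q)
        case (Pair s y)
        then have "\<bar>s - t\<bar> < \<bar>t - t0\<bar> - \<rho>" using that(2) dist_Pair_lessD(1)[of s y t x] tx by simp
        then have "\<not> \<bar>s - t0\<bar> \<le> \<rho>" by linarith
        then show ?thesis using s1(2)[of q] that Pair by (simp add: w_def)
      qed
      then show ?thesis using s1(1) False by (intro exI[of _ "min s1 (\<bar>t - t0\<bar> - \<rho>)"]) auto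
    qed
  qed
  moreover have inc_w: "unit_increment w"
    using inc_F inc\<psi> by (auto simp: unit_increment_def w_def)
  moreover have "w (t, x) \<le> G x" if t: "t \<ge> 0" for t x
  proof (cases "\<bar>t - t0\<bar> \<le> \<rho> \<and> ?F (t, x) < \<psi> (t, x)")
    case True
    then obtain k :: int where k: "\<bar>t - t0\<bar> < \<rho>" "\<bar>x + 2 * pi * of_int k - \<theta>0\<bar> < \<rho>"
      using small by blast
    let ?x = "x + 2 * pi * of_int k"
    have "dist (t, ?x) (t0, \<theta>0) < 3 * \<rho>" using k \<rho>(1) by (intro dist_box_less) auto
    then have "\<phi> (t, ?x) < \<phi> (t0, \<theta>0) + e" using r3(2)[of "(t, ?x)"] \<rho>(5) t by simp
    then have "\<psi> (t, ?x) \<le> b" using \<delta>(3) by (simp add: \<psi>_def M_def e_def field_simps)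
    also have "b \<le> G ?x" using k \<rho>(6) by (intro Gb) simp
    finally have "\<psi> (t, x) \<le> G x"
      using unit_increment_of_int[OF inc\<psi> t]
        unit_increment_of_int[of "\<lambda>(t, x). G x" t x k] t by (simp add: unit_increment_def increment)
    then show ?thesis using True by (simp add: w_def)
  next
    case False
    then show ?thesis using perron_solution_bounds(2)[OF t, of x] by (auto simp: w_def)
  qed
  moreover have "equation_lhs \<xi> (t1, \<theta>1) \<le> 0"
    if \<xi>: "test_function \<xi>" "t1 > 0" "strict_max_at (\<lambda>p. w p - \<xi> p) t1 \<theta>1" "dx \<xi> (t1, \<theta>1) \<noteq> 0"
    for \<xi> t1 \<theta>1
  proof (cases "\<bar>t1 - t0\<bar> \<le> \<rho> \<and> ?F (t1, \<theta>1) < \<psi> (t1, \<theta>1)")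
    \<comment> \<open>Where \<open>w\<close> agrees with the solution, a maximum of
      \<open>w - \<xi>\<close> is also one for the solution, since the solution is below
      \<open>w\<close>.\<close>
    case False
    then have eq: "w (t1, \<theta>1) = ?F (t1, \<theta>1)" by (auto simp: w_def)
    show ?thesis
    proof (rule subsolution_at_max[OF sub_F \<xi>(1,2) _ \<xi>(4)])
      fix p assume "p \<in> spacetime"
      then have "w p - \<xi> p \<le> w (t1, \<theta>1) - \<xi> (t1, \<theta>1)" using \<xi>(3) unfolding strict_max_at_def by blast
      then show "?F p - \<xi> p \<le> ?F (t1, \<theta>1) - \<xi> (t1, \<theta>1)" using Fw[of p] eq by simp
    qed
  next
    case True
    then obtain k :: int where k: "\<bar>t1 - t0\<bar> < \<rho>" "\<bar>\<theta>1 + 2 * pi * of_int k - \<theta>0\<bar> < \<rho>"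
      using small by blast
    have t1: "t1 \<ge> 0" using \<xi>(2) by simp
    let ?q = "(t1, \<theta>1 + 2 * pi * of_int k)"
    have "dist ?q (t0, \<theta>0) < 3 * \<rho>" using k \<rho>(1) by (intro dist_box_less) auto
    then have "equation_lhs \<phi> ?q < 0" "dx \<phi> ?q > 0" using r1(2)[of ?q] r2(2)[of ?q] \<rho> t1 by simp_all
    then have lhs: "equation_lhs \<phi> (t1, \<theta>1) < 0" and dpos: "dx \<phi> (t1, \<theta>1) > 0"
      using unit_increment_derivatives[OF \<phi> inc t1] by simp_all
    \<comment> \<open>Valid for all \<open>x\<close>: nearby times give equality of the time
      derivatives, and the full slice \<open>t1\<close> allows comparison of the
      half-Laplacians.\<close>
    have touch: "\<phi> (t, x) - \<xi> (t, x) \<le> \<phi> (t1, \<theta>1) - \<xi> (t1, \<theta>1)" if t: "\<bar>t - t0\<bar> < \<rho>" for t x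
    proof -
      have "(t, x) \<in> spacetime" using t \<rho> by simp
      then have "w (t, x) - \<xi> (t, x) \<le> w (t1, \<theta>1) - \<xi> (t1, \<theta>1)"
        using \<xi>(3) unfolding strict_max_at_def by blast
      moreover have "\<psi> (t, x) \<le> w (t, x)" using t by (simp add: w_def)
      moreover have "w (t1, \<theta>1) = \<psi> (t1, \<theta>1)" using True by (simp add: w_def)
      ultimately show ?thesis by (simp add: \<psi>_def)
    qed
    have "((\<lambda>s. \<phi> (s, \<theta>1) - \<xi> (s, \<theta>1)) has_real_derivative dt \<phi> (t1, \<theta>1) - dt \<xi> (t1, \<theta>1)) (at t1)"
      by (intro DERIV_diff test_function_DERIV_t \<phi> \<xi>)
    then have "dt \<phi> (t1, \<theta>1) - dt \<xi> (t1, \<theta>1) = 0"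
    proof (rule DERIV_local_max)
      show "0 < \<rho> - \<bar>t1 - t0\<bar>" using k by simp
      show "\<forall>s. \<bar>t1 - s\<bar> < \<rho> - \<bar>t1 - t0\<bar> \<longrightarrow>
          \<phi> (s, \<theta>1) - \<xi> (s, \<theta>1) \<le> \<phi> (t1, \<theta>1) - \<xi> (t1, \<theta>1)"
        by (intro allI impI touch) linarith
    qed
    moreover have "((\<lambda>x. \<phi> (t1, x) - \<xi> (t1, x)) has_real_derivative dx \<phi> (t1, \<theta>1) - dx \<xi> (t1, \<theta>1)) (at \<theta>1)"
      by (intro DERIV_diff test_function_DERIV_x \<phi> \<xi> t1)
    then have "dx \<phi> (t1, \<theta>1) - dx \<xi> (t1, \<theta>1) = 0"
      by (rule DERIV_local_max[where d = 1]) (use touch k in auto)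
    moreover have "half_laplacian (\<lambda>x. \<xi> (t1, x)) \<theta>1 \<le> half_laplacian (\<lambda>x. \<phi> (t1, x)) \<theta>1"
    proof -
      obtain L L' where "C11_with L (\<lambda>x. \<phi> (t1, x))" "C11_with L' (\<lambda>x. \<xi> (t1, x))"
        using test_function_C11[OF \<phi>] test_function_C11[OF \<xi>(1)] t1 by blast
      then show ?thesis
        by (rule half_laplacian_mono) (use touch[OF k(1)] in \<open>simp add: algebra_simps\<close>)
    qed
    then have "arctan (half_laplacian (\<lambda>x. \<xi> (t1, x)) \<theta>1 / max (dx \<phi> (t1, \<theta>1)) 0)
        \<le> arctan (half_laplacian (\<lambda>x. \<phi> (t1, x)) \<theta>1 / max (dx \<phi> (t1, \<theta>1)) 0)"
      by (intro arctan_monotone' divide_right_mono) auto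
    ultimately have "equation_lhs \<xi> (t1, \<theta>1) \<le> equation_lhs \<phi> (t1, \<theta>1)"
      by (simp add: equation_lhs_def divide_right_mono)
    then show ?thesis using lhs by simp
  qed
  ultimately have "w \<in> subsolutions_below G"
    using unit_increment_imp_periodic[OF inc_w]
    by (simp add: subsolutions_below_def viscosity_subsolution_def)
  then have wF: "w p \<le> ?F p" if "p \<in> spacetime" for p using that by (rule perron_solution_ge)
  obtain r4 where r4: "r4 > 0"
    "\<And>q. q \<in> spacetime \<Longrightarrow> dist q (t0, \<theta>0) < r4 \<Longrightarrow> \<phi> (t0, \<theta>0) - \<delta> / 2 < \<phi> q"
    using continuous_within_less[OF c\<phi>, of "\<phi> (t0, \<theta>0) - \<delta> / 2"] \<delta>(1) by auto
  \<comment> \<open>Near the contact point the solution dominates \<open>w\<close>, hence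
    \<open>\<psi>\<close>; its lower envelope would exceed its own value by
    \<open>\<delta> / 2\<close>.\<close>
  have "\<phi> (t0, \<theta>0) - \<delta> / 2 + (M + \<delta>) \<le> H (t0, \<theta>0)"
  proof (rule le_H[OF p0, of "min r4 \<rho>"])
    fix q :: "real \<times> real" assume q: "q \<in> spacetime" "dist q (t0, \<theta>0) < min r4 \<rho>"
    obtain t x where tx: "q = (t, x)" by fastforce
    then have "\<bar>t - t0\<bar> < \<rho>" using q(2) dist_Pair_lessD(1)[of t x t0 \<theta>0 \<rho>] by simp
    then have "\<psi> q \<le> w q" by (simp add: w_def tx)
    then show "\<phi> (t0, \<theta>0) - \<delta> / 2 + (M + \<delta>) \<le> ?F q"
      using wF[OF q(1)] r4(2)[OF q(1)] q(2) by (simp add: \<psi>_def)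
  qed (use r4(1) \<rho>(1) in simp)
  then show False using \<delta>(1) by (simp add: M_def)
qed

lemma perron_solution_viscosity_solution: "viscosity_solution (perron_solution G)"
proof -
  note inc = unit_increment_lower_envelope[OF locally_bounded_perron_solution unit_increment_perron_solution]
  have "viscosity_supersolution (lower_envelope spacetime (perron_solution G))"
    using perron_solution_supersolution_test inc unit_increment_imp_periodic[OF inc]
      lsc_on_lower_envelope[OF locally_bounded_perron_solution]
    unfolding viscosity_supersolution_def by blast
  then show ?thesis
    using perron_solution_mem locally_bounded_perron_solution
    by (simp add: viscosity_solution_def subsolutions_below_def)
qed

end

section \<open>The cumulative distribution function\<close>

lemma torus_prob_measure_translate:
  assumes "torus_prob_measure \<mu>" "A \<in> sets borel"
  shows "measure \<mu> ((\<lambda>x. x + 2 * pi) ` A) = measure \<mu> A"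
  using assms by (simp add: torus_prob_measure_def measure_def)

text \<open>The lift has infinite total mass and \<open>measure\<close> is 0 on sets of infinite
  mass, so finiteness must be secured before using additivity: a bounded set is covered by finitely
  many periods of mass 1.\<close>

lemma torus_prob_measure_finite:
  assumes \<mu>: "torus_prob_measure \<mu>" and A: "bounded A" "A \<in> sets borel"
  shows "A \<in> fmeasurable \<mu>"
proof -
  have sets: "sets \<mu> = sets borel" using \<mu> by (simp add: torus_prob_measure_def)
  define I where "I a = {a..<a + 2 * pi}" for a :: real
  have shift: "emeasure \<mu> (I (a + 2 * pi)) = emeasure \<mu> (I a)" for a
  proof -
    have "I (a + 2 * pi) = (\<lambda>x. x + 2 * pi) ` I a"
      by (simp add: I_def image_add_atLeastLessThan' add.commute)
    moreover have "I a \<in> sets borel" by (simp add: I_def)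
    ultimately show ?thesis using \<mu> unfolding torus_prob_measure_def by metis
  qed
  have one: "emeasure \<mu> (I (2 * pi * of_int k)) = 1" for k :: int
  proof (induction k rule: int_induct[where k = 0])
    case base
    then show ?case using \<mu> by (simp add: torus_prob_measure_def I_def)
  next
    case (step1 i)
    then show ?case using shift[of "2 * pi * of_int i"] by (simp add: algebra_simps)
  next
    case (step2 i)
    then show ?case using shift[of "2 * pi * of_int (i - 1)"] by (simp add: algebra_simps)
  qed
  obtain b where b: "\<And>x. x \<in> A \<Longrightarrow> \<bar>x\<bar> \<le> b" using A(1) by (auto simp: bounded_iff)
  define n where "n = \<lceil>b / (2 * pi)\<rceil>"
  have "A \<subseteq> (\<Union>k\<in>{- n - 1..n}. I (2 * pi * of_int k))"
  proof
    fix x assume "x \<in> A"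
    then have x: "\<bar>x / (2 * pi)\<bar> \<le> b / (2 * pi)" using b by (simp add: divide_right_mono)
    define k where "k = \<lfloor>x / (2 * pi)\<rfloor>"
    have k: "of_int k \<le> x / (2 * pi)" "x / (2 * pi) < of_int k + 1" unfolding k_def by linarith+
    then have "x \<in> I (2 * pi * of_int k)" by (simp add: I_def field_simps)
    moreover have "b / (2 * pi) \<le> of_int n" unfolding n_def by linarith
    then have "- of_int n - 1 < real_of_int k" "real_of_int k \<le> of_int n"
      using k x unfolding abs_le_iff by linarith+
    then have "k \<in> {- n - 1..n}" by simp
    ultimately show "x \<in> (\<Union>k\<in>{- n - 1..n}. I (2 * pi * of_int k))" by blast
  qed
  moreover have "(\<Union>k\<in>{- n - 1..n}. I (2 * pi * of_int k)) \<in> fmeasurable \<mu>"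
    by (intro fmeasurable.finite_UN) (auto simp: fmeasurable_def one sets I_def[symmetric], auto simp: I_def)
  ultimately show ?thesis using A(2) sets by (metis fmeasurableI2)
qed

text \<open>The formula for the distribution function changes at 0, so the signs of \<open>x\<close>
  and \<open>x + 2 * pi\<close> decide. In each case an interval is cut along a fundamental period
  and one piece is translated by \<open>2 * pi\<close>.\<close>

lemma torus_cdf_increment:
  assumes \<mu>: "torus_prob_measure \<mu>"
  shows "torus_cdf \<mu> (x + 2 * pi) = torus_cdf \<mu> x + 1"
proof -
  have fin: "{a..b} \<in> fmeasurable \<mu>" "{a<..<b} \<in> fmeasurable \<mu>" "{a..<b} \<in> fmeasurable \<mu>" for a b
    using torus_prob_measure_finite[OF \<mu>] by (auto intro: bounded_subset[OF bounded_closed_interval[of a b]])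
  have one: "measure \<mu> {0..<2 * pi} = 1" using \<mu> by (simp add: torus_prob_measure_def measure_def)
  have union: "measure \<mu> C = measure \<mu> A + measure \<mu> B"
    if "A \<union> B = C" "A \<inter> B = {}" "A \<in> fmeasurable \<mu>" "B \<in> fmeasurable \<mu>" for A B C
    using that measure_Un3[of A \<mu> B] by simp
  have translate: "measure \<mu> {x + 2 * pi<..<2 * pi} = measure \<mu> {x<..<0}"
  proof -
    have "(\<lambda>x. x + 2 * pi) ` {x<..<0} = {x + 2 * pi<..<2 * pi}"
      by (auto intro: image_eqI[of _ _ "y - 2 * pi" for y])
    then show ?thesis using torus_prob_measure_translate[OF \<mu>, of "{x<..<0}"] by simp
  qed
  consider "x \<ge> 0" | "x < 0" "x + 2 * pi \<ge> 0" | "x + 2 * pi < 0" by linarith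
  then show ?thesis
  proof cases
    case 1
    have "measure \<mu> {0..x + 2 * pi} = measure \<mu> {0..<2 * pi} + measure \<mu> {2 * pi..x + 2 * pi}"
      by (intro union fin ivl_disj_un_two(7)) (use 1 in auto)
    moreover have "measure \<mu> {2 * pi..x + 2 * pi} = measure \<mu> {0..x}"
      using torus_prob_measure_translate[OF \<mu>, of "{0..x}"] by simp
    ultimately show ?thesis using 1 one by (simp add: torus_cdf_def)
  next
    case 2
    have "measure \<mu> {0..<2 * pi} = measure \<mu> {0..x + 2 * pi} + measure \<mu> {x + 2 * pi<..<2 * pi}"
      using 2 by (intro union fin) auto
    then show ?thesis using translate 2 one by (simp add: torus_cdf_def)
  next
    case 3
    have "measure \<mu> {x + 2 * pi<..<2 * pi} = measure \<mu> {x + 2 * pi<..<0} + measure \<mu> {0..<2 * pi}"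
      by (intro union fin ivl_disj_un_two(1)) (use 3 in auto)
    moreover have "x < 0" using 3 pi_gt_zero by linarith
    ultimately show ?thesis using translate 3 one by (simp add: torus_cdf_def)
  qed
qed

theorem theorem1p1:
  fixes m :: real and \<mu> :: "real measure"
  assumes "m > 0"
    and "torus_prob_measure \<mu>"
    and "\<forall>\<theta> h. h \<ge> 0 \<longrightarrow> torus_cdf \<mu> (\<theta> + h) - torus_cdf \<mu> \<theta> \<ge> m * h"
  shows "\<exists>F :: real \<times> real \<Rightarrow> real.
    viscosity_solution F \<and>
    has_initial_condition F (torus_cdf \<mu>) \<and>
    (\<forall>t \<theta> h. t \<ge> 0 \<and> h \<ge> 0 \<longrightarrow> F (t, \<theta> + h) - F (t, \<theta>) \<ge> m * h)"
proof -
  define C where "C = torus_cdf \<mu>"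
  \<comment> \<open>The envelope supplies the semicontinuity asked of the barrier; increment and
    slope pass to it by the shift lemma.\<close>
  define G where "G = upper_envelope UNIV C"
  have slope: "C x + m * h \<le> C (x + h)" if "h \<ge> 0" for x h
    using assms(3)[rule_format, OF that, of x] by (simp add: C_def)
  have inc: "C (x + 2 * pi) = C x + 1" for x
    unfolding C_def by (rule torus_cdf_increment[OF assms(2)])
  have C_mono: "C x \<le> C y" if "x \<le> y" for x y
  proof -
    have "0 \<le> m * (y - x)" using assms(1) that by simp
    then show ?thesis using slope[of "y - x" x] that by simp
  qed
  have bdd: "locally_bounded_on UNIV C"
  proof (rule locally_bounded_onI)
    fix x :: real
    have "C (x - 1) \<le> C y \<and> C y \<le> C (x + 1)" if "dist y x < 1" for y
      using that by (auto simp: dist_real_def intro!: C_mono)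
    then show "\<exists>r>0. \<exists>a b. \<forall>y\<in>UNIV. dist y x < r \<longrightarrow> a \<le> C y \<and> C y \<le> b"
      by (metis zero_less_one)
  qed
  have CG: "C x \<le> G x" for x unfolding G_def by (rule upper_envelope_ge[OF bdd]) simp
  have shift: "G x + c \<le> G (x + h)" if "\<And>y. C y + c \<le> C (y + h)" for x h c
    unfolding G_def by (rule upper_envelope_shift[OF bdd]) (use that in auto)
  interpret perron_barrier G m
  proof
    show "usc_on UNIV G" unfolding G_def by (rule usc_on_upper_envelope[OF bdd])
    have "C y + - 1 \<le> C (y + - 2 * pi)" for y using inc[of "y + - 2 * pi"] by simp
    then show "G (x + 2 * pi) = G x + 1" for x
      \<comment> \<open>Forward and backward translation by a period give the two
        inequalities.\<close>
      using shift[of 1 "2 * pi" x] shift[of "- 1" "- 2 * pi" "x + 2 * pi"] inc by simp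
    show "G x + m * h \<le> G (x + h)" if "h \<ge> 0" for x h
      using slope[OF that] by (rule shift)
  qed (use assms(1) in simp)
  let ?F = "perron_solution G"
  have "has_initial_condition ?F C"
    unfolding has_initial_condition_def
  proof (intro conjI allI)
    fix x
    show "upper_envelope spacetime ?F (0, x) \<le> upper_envelope UNIV C x"
    proof (rule dense_ge)
      fix c assume "upper_envelope UNIV C x < c"
      then obtain r where r: "r > 0" "\<And>y. dist y x < r \<Longrightarrow> G y < c"
        using usc unfolding usc_on_iff G_def by force
      show "upper_envelope spacetime ?F (0, x) \<le> c"
      proof (rule upper_envelope_leI[OF locally_bounded_perron_solution _ r(1)])
        fix q :: "real \<times> real" assume q: "q \<in> spacetime" "dist q (0, x) < r"
        obtain s y where sy: "q = (s, y)" by fastforce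
        then have "G y < c" using r(2)[of y] dist_Pair_lessD[of s y 0 x r] q(2) by (simp add: dist_real_def)
        then show "?F q \<le> c" using perron_solution_bounds(2)[of s y] sy q(1) by simp
      next
        show "(0, x) \<in> spacetime" by simp
      qed
    qed
    show "lower_envelope UNIV C x \<le> lower_envelope spacetime ?F (0, x)"
    proof (rule dense_le)
      fix c assume "c < lower_envelope UNIV C x"
      then obtain d where d: "c < d" "d < lower_envelope UNIV C x" using dense by blast
      then obtain r where r: "r > 0" "\<And>y. dist y x < r \<Longrightarrow> d < C y"
        using less_lower_envelopeD[OF bdd, of x d] by auto
      \<comment> \<open>The time bound \<open>d - c\<close> pays for the descent of the lower
        barrier \<open>G y - s\<close>.\<close>
      show "c \<le> lower_envelope spacetime ?F (0, x)"
      proof (rule le_lower_envelopeI[OF locally_bounded_perron_solution, of _ "min r (d - c)"])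
        fix q :: "real \<times> real" assume q: "q \<in> spacetime" "dist q (0, x) < min r (d - c)"
        obtain s y where sy: "q = (s, y)" by fastforce
        then have "d < C y" "s < d - c"
          using r(2)[of y] dist_Pair_lessD[of s y 0 x "min r (d - c)"] q(2)
          by (simp_all add: dist_real_def abs_less_iff)
        then show "c \<le> ?F q" using perron_solution_bounds(1)[of s y] CG[of y] sy q(1) by simp
      qed (use r(1) d(1) in simp_all)
    qed
  qed
  moreover have "?F (t, \<theta> + h) - ?F (t, \<theta>) \<ge> m * h" if "t \<ge> 0" "h \<ge> 0" for t \<theta> h
    using perron_solution_slope[OF that, of \<theta>] by simp
  ultimately show ?thesis
    using perron_solution_viscosity_solution unfolding C_def by blast
qed

end
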